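(* Let $f$ be a nontrivial integral flow of an oriented signed graph $(\Sigma,\varepsilon)$. Then there exist minimal directed Eulerian walks $(W_i,\varepsilon_f)$ and Eulerian cycle-trees $T_i=\Sigma(W_i)$ such that \[ f=\sum_i f_{(W_i,\varepsilon_f)}=\sum_i[\varepsilon,\varepsilon_f]\cdot I_{T_i}. \] Furthermore, if $f$ is indecomposable, then there exist a minimal directed Eulerian walk $(W,\varepsilon_f)$ and an Eulerian cycle-tree $T=\Sigma(W)$ such that \[ f=f_{(W,\varepsilon_f)}=[\varepsilon,\varepsilon_f]\cdot I_T. \]
   Context: Signed graph $\Sigma=(V,E,\sigma)$: finite graph (loops, multiple edges allowed), $\sigma:E\to\{\pm1\}$. A cycle is a simple closed path (a loop is a cycle); balanced if its edge-sign product is $+1$, else unbalanced. Orientation $\varepsilon$: $\varepsilon(v,e)\in\{\pm1\}$ for $v$ an end-vertex of $e$, $0$ otherwise, $\varepsilon(u,e)\varepsilon(v,e)=-\sigma(e)$ for $e=uv$ (both values for a positive loop). Integral flow: $f:E\to\mathbb Z$ with $\sum_e m_{v,e}f(e)=0$ at each $v$, $m_{v,e}=\varepsilon(v,e)$ for non-loops, $2\varepsilon(v,e)$ for a negative loop at $v$, $0$ otherwise; nontrivial if $\operatorname{supp}f=\{e:f(e)\ne0\}\ne\emptyset$. $f$ is decomposable if $f=f_1+f_2$ with $f_1,f_2$ nontrivial integral flows and $f_1(e)f_2(e)\ge0$ for all $e$; a nontrivial integral flow that is not decomposable is indecomposable. Coupling: $[\varepsilon_1,\varepsilon_2](e)=\varepsilon_1(v,e)\varepsilon_2(v,e)$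 ($v$ an end-vertex) for $e$ in the domains of both, $0$ otherwise. $\varepsilon_f(u,x)=-\varepsilon(u,x)$ if $f(x)<0$, else $\varepsilon(u,x)$. Walk $W=u_0x_1u_1\cdots x_nu_n$ ($x_i$ has ends $u_{i-1},u_i$), sign $\prod\sigma(x_i)$, regarded as an edge multiset; $\Sigma(W)$ is the signed subgraph of its edges. Direction: values $\pm1$ on pairs $(u_{i-1},x_i),(u_i,x_i)$ with $\varepsilon_W(u_{i-1},x_i)\varepsilon_W(u_i,x_i)=-\sigma(x_i)$ and $\varepsilon_W(u_i,x_i)+\varepsilon_W(u_i,x_{i+1})=0$ (closed walks also require $\varepsilon_W(u_0,x_1)+\varepsilon_W(u_n,x_n)=0$). An Eulerian walk is a closed walk of sign $+1$ whose directions give the same orientation to all repeated occurrences of each edge; with a direction it is a directed Eulerian walk; it is minimal if no Eulerian walk is properly contained in it as edge multisets. $(W,\varepsilon_f)$ means $W$ with the direction given by $\varepsilon_f$. Characteristic vector: $f_{(W,\varepsilon_W)}(x)=\sum_{i:x_i=x}\varepsilon(v,x)\varepsilon_W(v,x_i)$. Cycle-tree: connected signed subgraph $T$ decomposed into edge-disjoint cycles (block cycles) and vertex-disjoint simple paths (block paths, possibly of length zero) such that the block cycles are all the cycles of $T$, two block cycles share at most one vertex (intersection vertex), each block path meets exactly two block cycles exactly at its two ends (intersection vertices), and every intersection vertex is a cut-point of $T$. Eulerian: each balanced block cycle has an even number, each unbalanced one an odd number, of intersection vertices. $I_T:E\to\mathbb Z$ is $1$ on block-cycle edges, $2$ on block-path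 edges, $0$ elsewhere.
   Formalization: "Minimal" means no directed Eulerian walk with the same edge directions is properly contained in (W, ε_f); minimality among all Eulerian walks as undirected edge multisets fails, e.g. two positive parallel edges with a negative loop at each end. *)

theory Defs
  imports Main "HOL-Library.Multiset"
begin

section \<open>Signed graphs\<close>

text \<open>
  Every edge \<open>e\<close> has two half-edges \<open>True\<close>, \<open>False\<close> (named in an arbitrary way), attached to the
  vertices \<open>ends G e True\<close> and \<open>ends G e False\<close>; \<open>e\<close> is a loop iff these coincide. Parallel edges
  are distinct elements of \<open>edges G\<close>.
\<close>

record ('v, 'e) sgraph =
  verts :: "'v set"
  edges :: "'e set"
  ends :: "'e \<Rightarrow> bool \<Rightarrow> 'v"
  esign :: "'e \<Rightarrow> int"

definition signed_graph :: "('v, 'e) sgraph \<Rightarrow> bool" where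
  "signed_graph G \<longleftrightarrow> finite (verts G) \<and> finite (edges G) \<and>
     (\<forall>e\<in>edges G. \<forall>h. ends G e h \<in> verts G) \<and>
     (\<forall>e\<in>edges G. esign G e \<in> {1, -1})"

definition signed_subgraph :: "('v, 'e) sgraph \<Rightarrow> ('v, 'e) sgraph \<Rightarrow> bool" where
  "signed_subgraph H G \<longleftrightarrow> signed_graph H \<and> verts H \<subseteq> verts G \<and> edges H \<subseteq> edges G \<and>
     ends H = ends G \<and> esign H = esign G"

definition is_loop :: "('v, 'e) sgraph \<Rightarrow> 'e \<Rightarrow> bool" where
  "is_loop G e \<longleftrightarrow> ends G e True = ends G e False"

definition edge_verts :: "('v, 'e) sgraph \<Rightarrow> 'e set \<Rightarrow> 'v set" where
  "edge_verts G A = {ends G e h | e h. e \<in> A}"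


section \<open>Components and cut-points\<close>

text \<open>
  Components are those of the underlying topological space, whose cells are the vertices and the
  open edges; an edge touches its end-vertices. In particular, when a vertex \<open>v\<close> is removed, the open
  arc of a loop at \<open>v\<close> survives as a component of its own. So a vertex at which a loop is attached to
  anything else is a cut-point, as it must be for the loop to be a block.
\<close>

definition cells :: "('v, 'e) sgraph \<Rightarrow> ('v + 'e) set" where
  "cells G = Inl ` verts G \<union> Inr ` edges G"

definition touching :: "('v, 'e) sgraph \<Rightarrow> (('v + 'e) \<times> ('v + 'e)) set" where
  "touching G = {(Inl (ends G e h), Inr e) | e h. e \<in> edges G}"

definition component_rel :: "('v, 'e) sgraph \<Rightarrow> ('v + 'e) set \<Rightarrow> (('v + 'e) \<times> ('v + 'e)) set" where
  "component_rel G S = ((touching G \<union> (touching G)\<inverse>) \<inter> S \<times> S)\<^sup>* \<inter> S \<times> S"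

definition num_components :: "('v, 'e) sgraph \<Rightarrow> ('v + 'e) set \<Rightarrow> nat" where
  "num_components G S = card (S // component_rel G S)"

definition connected_sgraph :: "('v, 'e) sgraph \<Rightarrow> bool" where
  "connected_sgraph G \<longleftrightarrow> num_components G (cells G) = 1"

definition cut_point :: "('v, 'e) sgraph \<Rightarrow> 'v \<Rightarrow> bool" where
  "cut_point G v \<longleftrightarrow> v \<in> verts G \<and>
     num_components G (cells G) < num_components G (cells G - {Inl v})"


section \<open>Orientations and integral flows\<close>

text \<open>
  An orientation assigns \<open>\<plusminus>1\<close> to each half-edge. The value on an edge which is not a
  loop is \<open>\<epsilon> e h = \<epsilon>(ends G e h, e)\<close>. On a negative loop the product rule makes both values equal; on
  a positive loop the two half-edges carry both values \<open>1\<close> and \<open>-1\<close>, and reversing the orientation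
  exchanges them. Orientations vanish outside their domain.
\<close>

definition orientation :: "('v, 'e) sgraph \<Rightarrow> ('e \<Rightarrow> bool \<Rightarrow> int) \<Rightarrow> bool" where
  "orientation G \<epsilon> \<longleftrightarrow>
     (\<forall>e\<in>edges G. (\<forall>h. \<epsilon> e h \<in> {1, -1}) \<and> \<epsilon> e True * \<epsilon> e False = - esign G e) \<and>
     (\<forall>e. e \<notin> edges G \<longrightarrow> (\<forall>h. \<epsilon> e h = 0))"

definition inc_coeff :: "('v, 'e) sgraph \<Rightarrow> ('e \<Rightarrow> bool \<Rightarrow> int) \<Rightarrow> 'v \<Rightarrow> 'e \<Rightarrow> int" where
  "inc_coeff G \<epsilon> v e =
     (if is_loop G e then
        (if ends G e True = v \<and> esign G e = -1 then 2 * \<epsilon> e True else 0)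
      else if ends G e True = v then \<epsilon> e True
      else if ends G e False = v then \<epsilon> e False
      else 0)"

text \<open>Only the values of a flow on \<open>edges G\<close> are relevant.\<close>

definition integral_flow ::
    "('v, 'e) sgraph \<Rightarrow> ('e \<Rightarrow> bool \<Rightarrow> int) \<Rightarrow> ('e \<Rightarrow> int) \<Rightarrow> bool" where
  "integral_flow G \<epsilon> f \<longleftrightarrow> (\<forall>v\<in>verts G. (\<Sum>e\<in>edges G. inc_coeff G \<epsilon> v e * f e) = 0)"

definition flow_supp :: "('v, 'e) sgraph \<Rightarrow> ('e \<Rightarrow> int) \<Rightarrow> 'e set" where
  "flow_supp G f = {e \<in> edges G. f e \<noteq> 0}"

definition nontrivial_flow ::
    "('v, 'e) sgraph \<Rightarrow> ('e \<Rightarrow> bool \<Rightarrow> int) \<Rightarrow> ('e \<Rightarrow> int) \<Rightarrow> bool" where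
  "nontrivial_flow G \<epsilon> f \<longleftrightarrow> integral_flow G \<epsilon> f \<and> flow_supp G f \<noteq> {}"

definition decomposable ::
    "('v, 'e) sgraph \<Rightarrow> ('e \<Rightarrow> bool \<Rightarrow> int) \<Rightarrow> ('e \<Rightarrow> int) \<Rightarrow> bool" where
  "decomposable G \<epsilon> f \<longleftrightarrow>
     (\<exists>f1 f2. nontrivial_flow G \<epsilon> f1 \<and> nontrivial_flow G \<epsilon> f2 \<and>
        (\<forall>e\<in>edges G. f e = f1 e + f2 e \<and> f1 e * f2 e \<ge> 0))"

definition indecomposable ::
    "('v, 'e) sgraph \<Rightarrow> ('e \<Rightarrow> bool \<Rightarrow> int) \<Rightarrow> ('e \<Rightarrow> int) \<Rightarrow> bool" where
  "indecomposable G \<epsilon> f \<longleftrightarrow> nontrivial_flow G \<epsilon> f \<and> \<not> decomposable G \<epsilon> f"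

text \<open>
  By the product rule, either half-edge gives the same coupling; it is \<open>0\<close> outside the common
  domain because orientations vanish there.
\<close>

definition coupling :: "('e \<Rightarrow> bool \<Rightarrow> int) \<Rightarrow> ('e \<Rightarrow> bool \<Rightarrow> int) \<Rightarrow> 'e \<Rightarrow> int" where
  "coupling \<epsilon>1 \<epsilon>2 e = \<epsilon>1 e True * \<epsilon>2 e True"

definition flow_orientation ::
    "('e \<Rightarrow> bool \<Rightarrow> int) \<Rightarrow> ('e \<Rightarrow> int) \<Rightarrow> 'e \<Rightarrow> bool \<Rightarrow> int" where
  "flow_orientation \<epsilon> f e h = (if f e < 0 then - \<epsilon> e h else \<epsilon> e h)"


section \<open>Walks\<close>

text \<open>
  A walk \<open>u\<^sub>0 x\<^sub>1 u\<^sub>1 \<dots> x\<^sub>n u\<^sub>n\<close> with \<open>n \<ge> 1\<close> is the list of its steps \<open>(x, h)\<close>: the edge \<open>x\<close> is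
  traversed starting with its half-edge \<open>h\<close> and ending with \<open>\<not> h\<close>.
\<close>

definition step_tail :: "('v, 'e) sgraph \<Rightarrow> 'e \<times> bool \<Rightarrow> 'v" where
  "step_tail G d = ends G (fst d) (snd d)"

definition step_head :: "('v, 'e) sgraph \<Rightarrow> 'e \<times> bool \<Rightarrow> 'v" where
  "step_head G d = ends G (fst d) (\<not> snd d)"

definition walk :: "('v, 'e) sgraph \<Rightarrow> ('e \<times> bool) list \<Rightarrow> bool" where
  "walk G w \<longleftrightarrow> w \<noteq> [] \<and> fst ` set w \<subseteq> edges G \<and>
     (\<forall>i. Suc i < length w \<longrightarrow> step_head G (w ! i) = step_tail G (w ! Suc i))"

definition closed_walk :: "('v, 'e) sgraph \<Rightarrow> ('e \<times> bool) list \<Rightarrow> bool" where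
  "closed_walk G w \<longleftrightarrow> walk G w \<and> step_head G (last w) = step_tail G (hd w)"

definition walk_sign :: "('v, 'e) sgraph \<Rightarrow> ('e \<times> bool) list \<Rightarrow> int" where
  "walk_sign G w = (\<Prod>d\<leftarrow>w. esign G (fst d))"

definition walk_subgraph :: "('v, 'e) sgraph \<Rightarrow> ('e \<times> bool) list \<Rightarrow> ('v, 'e) sgraph" where
  "walk_subgraph G w = G\<lparr>verts := edge_verts G (fst ` set w), edges := fst ` set w\<rparr>"

text \<open>
  \<open>\<delta> i h\<close> is the value of a direction on the half-edge \<open>h\<close> of the edge in step \<open>i\<close> (counted from \<open>0\<close>), so
  that step \<open>i\<close> starts with the value \<open>\<delta> i (snd (w ! i))\<close> and ends with \<open>\<delta> i (\<not> snd (w ! i))\<close>.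
\<close>

definition direction :: "('v, 'e) sgraph \<Rightarrow> ('e \<times> bool) list \<Rightarrow> (nat \<Rightarrow> bool \<Rightarrow> int) \<Rightarrow> bool" where
  "direction G w \<delta> \<longleftrightarrow>
     (\<forall>i<length w. (\<forall>h. \<delta> i h \<in> {1, -1}) \<and>
        \<delta> i (snd (w ! i)) * \<delta> i (\<not> snd (w ! i)) = - esign G (fst (w ! i))) \<and>
     (\<forall>i. Suc i < length w \<longrightarrow> \<delta> i (\<not> snd (w ! i)) + \<delta> (Suc i) (snd (w ! Suc i)) = 0) \<and>
     (closed_walk G w \<longrightarrow>
        \<delta> 0 (snd (hd w)) + \<delta> (length w - 1) (\<not> snd (last w)) = 0)"

definition coherent :: "('e \<times> bool) list \<Rightarrow> (nat \<Rightarrow> bool \<Rightarrow> int) \<Rightarrow> bool" where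
  "coherent w \<delta> \<longleftrightarrow>
     (\<forall>i<length w. \<forall>j<length w. fst (w ! i) = fst (w ! j) \<longrightarrow> \<delta> i = \<delta> j)"

definition eulerian_walk :: "('v, 'e) sgraph \<Rightarrow> ('e \<times> bool) list \<Rightarrow> bool" where
  "eulerian_walk G w \<longleftrightarrow> closed_walk G w \<and> walk_sign G w = 1 \<and>
     (\<forall>\<delta>. direction G w \<delta> \<longrightarrow> coherent w \<delta>)"

definition directed_eulerian_walk ::
    "('v, 'e) sgraph \<Rightarrow> ('e \<times> bool) list \<Rightarrow> (nat \<Rightarrow> bool \<Rightarrow> int) \<Rightarrow> bool" where
  "directed_eulerian_walk G w \<delta> \<longleftrightarrow> eulerian_walk G w \<and> direction G w \<delta>"

definition directed_edges ::
    "('e \<times> bool) list \<Rightarrow> (nat \<Rightarrow> bool \<Rightarrow> int) \<Rightarrow> ('e \<times> (bool \<Rightarrow> int)) multiset" where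
  "directed_edges w \<delta> = {# (fst (w ! i), \<delta> i). i \<in># mset [0..<length w] #}"

text \<open>
  Minimality of a directed Eulerian walk compares multisets of directed edges. Forgetting the
  directions gives a different notion: for two positive parallel edges \<open>a\<close>, \<open>b\<close> joining \<open>p\<close> and \<open>q\<close>, with
  negative loops \<open>k\<close> at \<open>p\<close> and \<open>l\<close> at \<open>q\<close>, the walk \<open>p k p a q l q b p\<close> carries an indecomposable flow,
  although its edges include those of the balanced cycle \<open>p a q b p\<close>, which no direction of that walk
  makes into a directed Eulerian walk.
\<close>

definition minimal_directed_eulerian_walk ::
    "('v, 'e) sgraph \<Rightarrow> ('e \<times> bool) list \<Rightarrow> (nat \<Rightarrow> bool \<Rightarrow> int) \<Rightarrow> bool" where
  "minimal_directed_eulerian_walk G w \<delta> \<longleftrightarrow> directed_eulerian_walk G w \<delta> \<and>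
     \<not> (\<exists>w' \<delta>'. directed_eulerian_walk G w' \<delta>' \<and> directed_edges w' \<delta>' \<subset># directed_edges w \<delta>)"

text \<open>The restriction of an orientation to the steps of a walk (a candidate for a direction).\<close>

definition dir_of :: "('e \<Rightarrow> bool \<Rightarrow> int) \<Rightarrow> ('e \<times> bool) list \<Rightarrow> nat \<Rightarrow> bool \<Rightarrow> int" where
  "dir_of \<epsilon> w i = \<epsilon> (fst (w ! i))"

definition char_vec ::
    "('e \<Rightarrow> bool \<Rightarrow> int) \<Rightarrow> ('e \<times> bool) list \<Rightarrow> (nat \<Rightarrow> bool \<Rightarrow> int) \<Rightarrow> 'e \<Rightarrow> int" where
  "char_vec \<epsilon> w \<delta> x =
     (\<Sum>i | i < length w \<and> fst (w ! i) = x. \<epsilon> x (snd (w ! i)) * \<delta> i (snd (w ! i)))"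


section \<open>Cycles, paths and cycle-trees\<close>

text \<open>Cycles are represented by their edge sets. For length 2, distinctness of edges matters.\<close>

definition is_cycle :: "('v, 'e) sgraph \<Rightarrow> 'e set \<Rightarrow> bool" where
  "is_cycle G C \<longleftrightarrow> (\<exists>w. closed_walk G w \<and> distinct (map (step_tail G) w) \<and>
     distinct (map fst w) \<and> C = fst ` set w)"

definition balanced :: "('v, 'e) sgraph \<Rightarrow> 'e set \<Rightarrow> bool" where
  "balanced G C \<longleftrightarrow> (\<Prod>e\<in>C. esign G e) = 1"

text \<open>Paths carry their initial vertex, to allow for length zero.\<close>

definition path_verts :: "('v, 'e) sgraph \<Rightarrow> 'v \<times> ('e \<times> bool) list \<Rightarrow> 'v list" where
  "path_verts G p = fst p # map (step_head G) (snd p)"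

definition path_edges :: "'v \<times> ('e \<times> bool) list \<Rightarrow> 'e set" where
  "path_edges p = fst ` set (snd p)"

definition simple_path :: "('v, 'e) sgraph \<Rightarrow> 'v \<times> ('e \<times> bool) list \<Rightarrow> bool" where
  "simple_path G p \<longleftrightarrow> fst p \<in> verts G \<and> path_edges p \<subseteq> edges G \<and>
     (\<forall>i<length (snd p). step_tail G (snd p ! i) = path_verts G p ! i) \<and>
     distinct (path_verts G p)"

definition intersection_verts ::
    "('v, 'e) sgraph \<Rightarrow> 'e set set \<Rightarrow> ('v \<times> ('e \<times> bool) list) set \<Rightarrow> 'v set" where
  "intersection_verts G \<C> \<P> =
     {v. \<exists>C\<in>\<C>. \<exists>D\<in>\<C>. C \<noteq> D \<and> v \<in> edge_verts G C \<inter> edge_verts G D} \<union>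
     (\<Union>p\<in>\<P>. {hd (path_verts G p), last (path_verts G p)})"

text \<open>\<open>T\<close> is a cycle-tree in \<open>G\<close> with set of block cycles \<open>\<C>\<close> and set of block paths \<open>\<P>\<close>.\<close>

definition cycle_tree ::
    "('v, 'e) sgraph \<Rightarrow> ('v, 'e) sgraph \<Rightarrow> 'e set set \<Rightarrow> ('v \<times> ('e \<times> bool) list) set \<Rightarrow> bool" where
  "cycle_tree G T \<C> \<P> \<longleftrightarrow>
     signed_subgraph T G \<and> connected_sgraph T \<and>
     edges T = \<Union>\<C> \<union> (\<Union>p\<in>\<P>. path_edges p) \<and>
     verts T = edge_verts T (\<Union>\<C>) \<union> (\<Union>p\<in>\<P>. set (path_verts T p)) \<and>
     \<C> = {C. is_cycle T C} \<and>
     (\<forall>p\<in>\<P>. simple_path T p) \<and>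
     (\<forall>C\<in>\<C>. \<forall>D\<in>\<C>. C \<noteq> D \<longrightarrow> C \<inter> D = {}) \<and>
     (\<forall>C\<in>\<C>. \<forall>p\<in>\<P>. C \<inter> path_edges p = {}) \<and>
     (\<forall>p\<in>\<P>. \<forall>q\<in>\<P>. p \<noteq> q \<longrightarrow> set (path_verts T p) \<inter> set (path_verts T q) = {}) \<and>
     (\<forall>C\<in>\<C>. \<forall>D\<in>\<C>. C \<noteq> D \<longrightarrow> card (edge_verts T C \<inter> edge_verts T D) \<le> 1) \<and>
     (\<forall>p\<in>\<P>. \<exists>C\<in>\<C>. \<exists>D\<in>\<C>. C \<noteq> D \<and>
        set (path_verts T p) \<inter> edge_verts T C = {hd (path_verts T p)} \<and>
        set (path_verts T p) \<inter> edge_verts T D = {last (path_verts T p)} \<and>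
        (\<forall>B\<in>\<C> - {C, D}. set (path_verts T p) \<inter> edge_verts T B = {})) \<and>
     (\<forall>v\<in>intersection_verts T \<C> \<P>. cut_point T v)"

definition eulerian_cycle_tree ::
    "('v, 'e) sgraph \<Rightarrow> ('v, 'e) sgraph \<Rightarrow> 'e set set \<Rightarrow> ('v \<times> ('e \<times> bool) list) set \<Rightarrow> bool" where
  "eulerian_cycle_tree G T \<C> \<P> \<longleftrightarrow> cycle_tree G T \<C> \<P> \<and>
     (\<forall>C\<in>\<C>. (balanced T C \<longrightarrow> even (card (edge_verts T C \<inter> intersection_verts T \<C> \<P>))) \<and>
            (\<not> balanced T C \<longrightarrow> odd (card (edge_verts T C \<inter> intersection_verts T \<C> \<P>))))"

definition tree_indicator ::
    "'e set set \<Rightarrow> ('v \<times> ('e \<times> bool) list) set \<Rightarrow> 'e \<Rightarrow> int" where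
  "tree_indicator \<C> \<P> e =
     (if e \<in> \<Union>\<C> then 1 else if e \<in> (\<Union>p\<in>\<P>. path_edges p) then 2 else 0)"

end

theory Submission
  imports Defs
begin

text \<open>
  Reversing the edges on which \<open>f\<close> is negative turns \<open>f\<close> into the nonnegative flow \<open>\<bar>f\<bar>\<close>, and
  directed Eulerian walks become closed trails that leave every vertex through a half-edge opposite in
  value to the one of arrival. A maximal such trail within \<open>\<bar>f\<bar>\<close> is closed, by conservation of flow;
  removing minimal ones repeatedly decomposes \<open>f\<close>.

  A minimal trail passes every vertex at most twice, since a repeated state would split it. If it passes
  \<open>u\<close> twice, it consists of two closed parts at \<open>u\<close>, one starting and ending with positive and the other
  with negative half-edges. These parts share only \<open>u\<close>: at another common vertex, either they can be
  recombined into a shorter closed trail, or they can be after reversing one of them. So every vertex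
  passed twice is a cut-point, and a cycle stays on one side of it. It follows that the edges traversed
  twice are the bridges and form disjoint paths, that every edge traversed once lies on exactly one
  cycle, and that along a cycle the half-edges at a vertex agree in value exactly at the intersection
  vertices, which gives the parity condition.
\<close>

section \<open>Half-edges and routes\<close>

text \<open>Coherence of an Eulerian walk quantifies over all of its directions, but a direction is
  determined by a single one of its values; for a walk directed by \<omega>, every direction is
  \<omega> or its negative along the walk. Fixing \<omega> therefore reduces directed edges to edges
  and minimality to a comparison of edge multisets. A part of a walk and its reversal have the same
  edge multiset, which is why recombining with a reversed part can contradict minimality. The
  obstacle is that a cycle of the underlying graph need not be an interval of the walk, nor be
  directed by \<omega>. Cycles are reached through the local structure at a vertex instead: each
  visited state is left once and entered once, so that at most two half-edges there carry the same
  value, and at a double vertex the value of a half-edge tells its side. The resulting pairing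
  \<open>partner\<close> dictates how a cycle has to continue.\<close>

definition flip :: "'e \<times> bool \<Rightarrow> 'e \<times> bool" where
  "flip d = (fst d, \<not> snd d)"

lemma flip_simps [simp]:
  "fst (flip d) = fst d" "snd (flip d) = (\<not> snd d)" "flip (flip d) = d" "flip d \<noteq> d" "d \<noteq> flip d"
  "step_tail G (flip d) = step_head G d" "step_head G (flip d) = step_tail G d"
  by (auto simp: flip_def step_tail_def step_head_def prod_eq_iff)

lemma eq_or_flip: "fst x = fst y \<Longrightarrow> x = y \<or> x = flip y"
  by (auto simp: flip_def prod_eq_iff)

text \<open>A pair \<open>x\<close> plays two roles in this proof: a step of a walk, and the
  half-edge through which that step departs, attached to the vertex \<open>step_tail G x\<close>.
  Membership is phrased here in the second role.\<close>

lemma mem_edge_verts_iff: "v \<in> edge_verts G A \<longleftrightarrow> (\<exists>x. fst x \<in> A \<and> step_tail G x = v)"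
  by (force simp: edge_verts_def step_tail_def)

lemma step_tail_in_edge_verts: "fst x \<in> A \<Longrightarrow> step_tail G x \<in> edge_verts G A"
  unfolding mem_edge_verts_iff by blast

lemma step_head_in_edge_verts: "fst x \<in> A \<Longrightarrow> step_head G x \<in> edge_verts G A"
  using step_tail_in_edge_verts[of "flip x"] by simp

text \<open>Unlike \<open>walk\<close>, this admits the empty list and names both end-vertices, so
  that splitting and joining at arbitrary places have no side conditions.\<close>

primrec route :: "('v, 'e) sgraph \<Rightarrow> 'v \<Rightarrow> ('e \<times> bool) list \<Rightarrow> 'v \<Rightarrow> bool" where
  "route G u [] v \<longleftrightarrow> u = v"
| "route G u (d # c) v \<longleftrightarrow> step_tail G d = u \<and> route G (step_head G d) c v"

lemma route_append: "route G u (xs @ ys) v \<longleftrightarrow> (\<exists>z. route G u xs z \<and> route G z ys v)"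
  by (induction xs arbitrary: u) auto

lemma route_iff:
  "c \<noteq> [] \<Longrightarrow> route G u c v \<longleftrightarrow> step_tail G (hd c) = u \<and> step_head G (last c) = v \<and>
     (\<forall>i. Suc i < length c \<longrightarrow> step_head G (c ! i) = step_tail G (c ! Suc i))"
proof (induction c arbitrary: u)
  case (Cons d c)
  show ?case
  proof (cases c)
    case (Cons d' c')
    have "(\<forall>i. Suc i < length (d # c) \<longrightarrow> step_head G ((d # c) ! i) = step_tail G ((d # c) ! Suc i)) \<longleftrightarrow>
       step_head G d = step_tail G d' \<and>
       (\<forall>i. Suc i < length c \<longrightarrow> step_head G (c ! i) = step_tail G (c ! Suc i))" (is "(\<forall>i. ?P i) \<longleftrightarrow> _")
    proof -
      have "(\<forall>i. ?P i) \<longleftrightarrow> ?P 0 \<and> (\<forall>i. ?P (Suc i))"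
        by (metis not0_implies_Suc)
      then show ?thesis
        by (simp add: Cons)
    qed
    then show ?thesis
      using Cons.IH Cons by auto
  qed auto
qed auto

lemma closed_walk_iff_route:
  "closed_walk G c \<longleftrightarrow> c \<noteq> [] \<and> fst ` set c \<subseteq> edges G \<and> (\<exists>u. route G u c u)"
  by (cases "c = []") (auto simp: closed_walk_def walk_def route_iff)

text \<open>The list of visited vertices can be read from the heads or from the tails. Comparing
  both readings replaces index arguments, for instance in \<open>closed_route_heads\<close>.\<close>

lemma route_verts: "route G u c v \<Longrightarrow> u # map (step_head G) c = map (step_tail G) c @ [v]"
  by (induction c arbitrary: u) auto

lemma route_rotate: "route G u (xs @ ys) u \<Longrightarrow> \<exists>v. route G v (ys @ xs) v"
  by (auto simp: route_append)

lemma closed_route_heads: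
  assumes "route G u c u"
  shows "mset (map (step_head G) c) = mset (map (step_tail G) c)"
proof -
  have "mset (u # map (step_head G) c) = mset (map (step_tail G) c @ [u])"
    using route_verts[OF assms] by metis
  then show ?thesis
    by simp
qed

lemma closed_route_succ:
  assumes "route G u c u" "d \<in> set c"
  obtains d' where "d' \<in> set c" "step_tail G d' = step_head G d"
proof -
  have "step_head G d \<in> set (map (step_tail G) c)"
    using closed_route_heads[OF assms(1)] assms(2) by (metis image_eqI set_map set_mset_mset)
  then show ?thesis
    using that by auto
qed

lemma closed_route_pred:
  assumes "route G u c u" "d \<in> set c"
  obtains d' where "d' \<in> set c" "step_head G d' = step_tail G d"
proof -
  have "step_tail G d \<in> set (map (step_head G) c)"
    using closed_route_heads[OF assms(1)] assms(2) by (metis image_eqI set_map set_mset_mset)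
  then show ?thesis
    using that by auto
qed

lemma closed_route_verts:
  assumes "route G u c u"
  shows "edge_verts G (fst ` set c) = step_tail G ` set c"
proof
  show "edge_verts G (fst ` set c) \<subseteq> step_tail G ` set c"
  proof
    fix v assume "v \<in> edge_verts G (fst ` set c)"
    then obtain x d where x: "step_tail G x = v" "d \<in> set c" "fst x = fst d"
      by (auto simp: mem_edge_verts_iff)
    obtain d' where "d' \<in> set c" "step_tail G d' = step_head G d"
      using closed_route_succ[OF assms x(2)] .
    then show "v \<in> step_tail G ` set c"
      using eq_or_flip[OF x(3)] x by (auto simp: image_iff intro: bexI[of _ d] bexI[of _ d'])
  qed
qed (auto intro: step_tail_in_edge_verts)

lemma route_induct_along:
  assumes "route G u (d # c) v" "P d"
    and "\<And>x y. x \<in> set (d # c) \<Longrightarrow> y \<in> set (d # c) \<Longrightarrow> step_tail G y = step_head G x \<Longrightarrow> P x \<Longrightarrow> P y"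
  shows "\<forall>x\<in>set (d # c). P x"
  using assms
proof (induction c arbitrary: u d)
  case (Cons d' c)
  have "\<forall>x\<in>set (d' # c). P x"
  proof (rule Cons.IH)
    show "route G (step_head G d) (d' # c) v"
      using Cons.prems(1) by auto
    show "P d'"
      using Cons.prems(1,2) by (intro Cons.prems(3)[of d d']) auto
  qed (use Cons.prems(3) in auto)
  then show ?case
    using Cons.prems(2) by auto
qed auto

text \<open>Rotating the closed route so that it starts with \<open>d\<close> reduces this to
  \<open>route_induct_along\<close>.\<close>

lemma closed_route_induct:
  assumes "route G u c u" "d \<in> set c" "P d"
    and "\<And>x y. x \<in> set c \<Longrightarrow> y \<in> set c \<Longrightarrow> step_tail G y = step_head G x \<Longrightarrow> P x \<Longrightarrow> P y"
  shows "\<forall>x\<in>set c. P x"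
proof -
  obtain xs ys where c: "c = xs @ d # ys"
    using assms(2) by (metis split_list)
  obtain v where "route G v (d # ys @ xs) v"
    using route_rotate[of G u xs "d # ys"] assms(1) c by auto
  then have "\<forall>x\<in>set (d # ys @ xs). P x"
    using assms c by (intro route_induct_along[where P = P]) auto
  then show ?thesis
    using c by auto
qed

text \<open>Loop erasure: when the first vertex recurs in the shortened remainder, everything before
  the recurrence is dropped.\<close>

lemma route_shortcut:
  "route G u c v \<Longrightarrow> \<exists>c'. route G u c' v \<and> set c' \<subseteq> set c \<and> distinct (map (step_tail G) c' @ [v])"
proof (induction c arbitrary: u)
  case (Cons d c)
  from Cons.prems have "route G (step_head G d) c v"
    by simp
  from Cons.IH[OF this] obtain c' where c': "route G (step_head G d) c' v" "set c' \<subseteq> set c"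
      "distinct (map (step_tail G) c' @ [v])"
    by blast
  show ?case
  proof (cases "u \<in> set (map (step_tail G) c' @ [v])")
    case False
    with c' Cons.prems show ?thesis
      by (intro exI[of _ "d # c'"]) auto
  next
    case True
    show ?thesis
    proof (cases "u = v")
      case True
      then show ?thesis
        by (intro exI[of _ "[]"]) auto
    next
      case False
      with True obtain x where x: "x \<in> set c'" "step_tail G x = u"
        by auto
      then obtain xs ys where "c' = xs @ x # ys"
        by (metis split_list)
      with x c' show ?thesis
        by (intro exI[of _ "x # ys"]) (auto simp: route_append)
    qed
  qed
qed auto

text \<open>A later traversal of the same edge departs from the first vertex again or arrives there,
  and either way that vertex repeats.\<close>

lemma simple_route_distinct_edges:
  "route G u c v \<Longrightarrow> distinct (map (step_tail G) c @ [v]) \<Longrightarrow> distinct (map fst c)"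
proof (induction c arbitrary: u)
  case (Cons d c)
  have "fst d \<notin> fst ` set c"
  proof
    assume "fst d \<in> fst ` set c"
    then obtain d' where d': "d' \<in> set c" "fst d' = fst d"
      by auto
    have verts: "step_head G d # map (step_head G) c = map (step_tail G) c @ [v]"
      using Cons.prems(1) by (intro route_verts) auto
    have "step_head G d' \<in> set (map (step_tail G) c @ [v])"
      using verts d'(1) by (metis image_eqI list.set_intros(2) list.set_map)
    then show False
      using eq_or_flip[OF d'(2)] d'(1) Cons.prems(2) by auto
  qed
  then show ?case
    using Cons by auto
qed auto

section \<open>Cycles\<close>

definition cycle_walk :: "('v, 'e) sgraph \<Rightarrow> ('e \<times> bool) list \<Rightarrow> bool" where
  "cycle_walk G c \<longleftrightarrow> closed_walk G c \<and> distinct (map (step_tail G) c) \<and> distinct (map fst c)"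

lemma is_cycle_iff: "is_cycle G C \<longleftrightarrow> (\<exists>c. cycle_walk G c \<and> C = fst ` set c)"
  by (auto simp: is_cycle_def cycle_walk_def)

lemma cycle_walk_route: "cycle_walk G c \<Longrightarrow> \<exists>u. route G u c u"
  by (auto simp: cycle_walk_def closed_walk_iff_route)

lemma cycle_walk_inj:
  assumes "cycle_walk G c"
  shows "inj_on fst (set c)" "inj_on (step_tail G) (set c)" "inj_on (step_head G) (set c)"
proof -
  have "distinct (map (step_tail G) c)" "distinct (map fst c)"
    using assms by (auto simp: cycle_walk_def)
  moreover from this have "distinct (map (step_head G) c)"
    using cycle_walk_route[OF assms] closed_route_heads by (metis mset_eq_imp_distinct_iff)
  ultimately show "inj_on fst (set c)" "inj_on (step_tail G) (set c)" "inj_on (step_head G) (set c)"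
    by (auto simp: distinct_map)
qed

text \<open>The hypothesis that the edge of \<open>d\<close> does not occur in \<open>c\<close>
  excludes \<open>[d, flip d]\<close>, which goes back along the same edge.\<close>

lemma cycle_walk_of_simple_route:
  assumes "route G (step_head G d) c (step_tail G d)"
    and "distinct (map (step_tail G) c @ [step_tail G d])"
    and "fst d \<notin> fst ` set c" "fst ` set (d # c) \<subseteq> edges G"
  shows "cycle_walk G (d # c)"
  using assms simple_route_distinct_edges[OF assms(1,2)]
  by (auto simp: cycle_walk_def closed_walk_iff_route)

text \<open>A change of sides happens at a common vertex of both, hence at \<open>a\<close>. The
  first step is exempt from avoiding \<open>a\<close>, so that the route may start there.\<close>

lemma route_one_side:
  assumes "route G u (d # c) v" "fst ` set (d # c) \<subseteq> A \<union> B"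
    and "edge_verts G A \<inter> edge_verts G B \<subseteq> {a}" "a \<notin> step_tail G ` set c" "fst d \<in> A"
  shows "fst ` set (d # c) \<subseteq> A"
  using assms
proof (induction c arbitrary: u d)
  case (Cons d' c)
  have "fst d' \<in> A"
  proof (rule ccontr)
    assume "fst d' \<notin> A"
    then have "fst d' \<in> B"
      using Cons.prems(2) by auto
    then have "step_tail G d' \<in> edge_verts G A \<inter> edge_verts G B"
      using Cons.prems(1) step_tail_in_edge_verts[of d' B G] step_head_in_edge_verts[OF Cons.prems(5), of G]
      by auto
    then show False
      using Cons.prems(3,4) by auto
  qed
  moreover have "route G (step_head G d) (d' # c) v"
    using Cons.prems(1) by auto
  ultimately have "fst ` set (d' # c) \<subseteq> A"
    using Cons.IH[of "step_head G d" d'] Cons.prems by auto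
  then show ?case
    using Cons.prems(5) by auto
qed auto

text \<open>A cycle departs from \<open>a\<close> at most once; rotated to start there, it avoids
  \<open>a\<close> at all later departures and \<open>route_one_side\<close> applies.\<close>

lemma cycle_one_side:
  assumes "cycle_walk G c" "fst ` set c \<subseteq> A \<union> B" "edge_verts G A \<inter> edge_verts G B \<subseteq> {a}"
  shows "fst ` set c \<subseteq> A \<or> fst ` set c \<subseteq> B"
proof -
  obtain u where u: "route G u c u"
    using cycle_walk_route[OF assms(1)] by auto
  have "c \<noteq> []"
    using assms(1) by (auto simp: cycle_walk_def closed_walk_iff_route)
  obtain d c' v where d: "route G v (d # c') v" "set (d # c') = set c" "a \<notin> step_tail G ` set c'"
  proof (cases "a \<in> step_tail G ` set c")
    case False
    moreover from \<open>c \<noteq> []\<close> obtain d c' where "c = d # c'"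
      by (cases c) auto
    ultimately show ?thesis
      using u that[of u d c'] by auto
  next
    case True
    then obtain d where d: "d \<in> set c" "step_tail G d = a"
      by auto
    then obtain xs ys where c: "c = xs @ d # ys"
      by (metis split_list)
    obtain v where "route G v (d # ys @ xs) v"
      using route_rotate[of G u xs "d # ys"] u c by auto
    moreover have "a \<notin> step_tail G ` set (ys @ xs)"
      using assms(1) c d by (auto simp: cycle_walk_def)
    ultimately show ?thesis
      using that[of v d "ys @ xs"] c by auto
  qed
  have "fst d \<in> A \<or> fst d \<in> B"
    using assms(2) d(2) by auto
  then show ?thesis
    using route_one_side[OF d(1), of A B a] route_one_side[OF d(1), of B A a] assms(2,3) d(2,3)
    by (metis Int_commute Un_commute)
qed

section \<open>Trails in a bidirected graph\<close>

text \<open>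
  A walk directed by \<open>\<omega>\<close> is a path in the digraph whose nodes are the states \<open>(v, s)\<close>: being at \<open>v\<close> and
  having to leave through a half-edge of value \<open>s\<close>. The map \<open>opp\<close> on states, together with \<open>flip\<close>,
  reverses all arcs.
\<close>

definition opp :: "'v \<times> int \<Rightarrow> 'v \<times> int" where
  "opp p = (fst p, - snd p)"

lemma opp_simps [simp]: "fst (opp p) = fst p" "snd (opp p) = - snd p" "opp (opp p) = p"
    "opp p = opp q \<longleftrightarrow> p = q"
  by (auto simp: opp_def prod_eq_iff)

definition mult :: "('e \<times> bool) list \<Rightarrow> 'e \<Rightarrow> nat" where
  "mult w e = count (mset (map fst w)) e"

lemma sum_list_mult:
  assumes "finite A" "fst ` set w \<subseteq> A"
  shows "(\<Sum>d\<leftarrow>w. F (fst d)) = (\<Sum>e\<in>A. F e * int (mult w e))"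
  using assms(2)
proof (induction w)
  case (Cons d w)
  have "(\<Sum>e\<in>A. F e * int (mult (d # w) e)) = (\<Sum>e\<in>A. (if e = fst d then F e else 0) + F e * int (mult w e))"
    by (rule sum.cong) (auto simp: mult_def algebra_simps)
  also have "\<dots> = F (fst d) + (\<Sum>e\<in>A. F e * int (mult w e))"
    using assms(1) Cons.prems by (simp add: sum.distrib)
  finally show ?case
    using Cons by auto
qed (auto simp: mult_def)

locale bidirected_graph =
  fixes G :: "('v, 'e) sgraph" and \<omega> :: "'e \<Rightarrow> bool \<Rightarrow> int"
  assumes graph: "signed_graph G" and orient: "orientation G \<omega>"
begin

definition src :: "'e \<times> bool \<Rightarrow> 'v \<times> int" where
  "src d = (step_tail G d, \<omega> (fst d) (snd d))"

text \<open>The minus sign encodes the rule that the values of arrival and departure at a vertex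
  cancel: one step may follow another iff its \<open>src\<close> is the \<open>tgt\<close> of the
  other.\<close>

definition tgt :: "'e \<times> bool \<Rightarrow> 'v \<times> int" where
  "tgt d = (step_head G d, - \<omega> (fst d) (\<not> snd d))"

lemma fst_src [simp]: "fst (src d) = step_tail G d" and fst_tgt [simp]: "fst (tgt d) = step_head G d"
  by (auto simp: src_def tgt_def)

lemma src_flip [simp]: "src (flip d) = opp (tgt d)" and tgt_flip [simp]: "tgt (flip d) = opp (src d)"
  by (auto simp: src_def tgt_def opp_def)

lemma omega_values: "e \<in> edges G \<Longrightarrow> \<omega> e h = 1 \<or> \<omega> e h = - 1"
  and omega_prod: "e \<in> edges G \<Longrightarrow> \<omega> e True * \<omega> e False = - esign G e"
  using orient by (auto simp: orientation_def)

lemma omega_prod': "e \<in> edges G \<Longrightarrow> \<omega> e h * \<omega> e (\<not> h) = - esign G e"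
  using omega_prod[of e] by (cases h) (auto simp: mult.commute)

lemma esign_values: "e \<in> edges G \<Longrightarrow> esign G e = 1 \<or> esign G e = - 1"
  using graph by (auto simp: signed_graph_def)

lemma finite_edges: "finite (edges G)"
  using graph by (auto simp: signed_graph_def)

lemma step_tail_verts: "fst d \<in> edges G \<Longrightarrow> step_tail G d \<in> verts G"
  using graph by (auto simp: signed_graph_def step_tail_def)

lemma snd_src_values: "fst d \<in> edges G \<Longrightarrow> snd (src d) = 1 \<or> snd (src d) = - 1"
  using omega_values by (auto simp: src_def)

lemma snd_tgt: "fst d \<in> edges G \<Longrightarrow> snd (tgt d) = esign G (fst d) * snd (src d)"
  using omega_prod'[of "fst d" "snd d"] omega_values[of "fst d" "snd d"] omega_values[of "fst d" "\<not> snd d"]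
  by (auto simp: src_def tgt_def)

primrec trail :: "'v \<times> int \<Rightarrow> ('e \<times> bool) list \<Rightarrow> 'v \<times> int \<Rightarrow> bool" where
  "trail p [] q \<longleftrightarrow> p = q"
| "trail p (d # w) q \<longleftrightarrow> fst d \<in> edges G \<and> src d = p \<and> trail (tgt d) w q"

lemma trail_append: "trail p (xs @ ys) q \<longleftrightarrow> (\<exists>r. trail p xs r \<and> trail r ys q)"
  by (induction xs arbitrary: p) auto

text \<open>Reversal exchanges departures and arrivals, so that states become opposite while
  \<omega> stays the same. This makes a reversed part available for recombination with an unreversed
  one.\<close>

lemma trail_reverse: "trail p w q \<Longrightarrow> trail (opp q) (rev (map flip w)) (opp p)"
proof (induction w arbitrary: p)
  case (Cons d w)
  then have "trail (opp q) (rev (map flip w)) (opp (tgt d))"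
    by simp
  with Cons.prems show ?case
    by (simp only: trail.simps list.map rev.simps trail_append src_flip tgt_flip flip_simps) blast
qed auto

lemma trail_edges: "trail p w q \<Longrightarrow> fst ` set w \<subseteq> edges G"
proof (induction w arbitrary: p)
  case (Cons d w)
  then have "fst ` set w \<subseteq> edges G"
    using Cons.IH[of "tgt d"] by simp
  with Cons.prems show ?case
    by simp
qed auto

lemma trail_route: "trail p w q \<Longrightarrow> route G (fst p) w (fst q)"
proof (induction w arbitrary: p)
  case (Cons d w)
  then have "route G (step_head G d) w (fst q)"
    using Cons.IH[of "tgt d"] by simp
  with Cons.prems show ?case
    by auto
qed auto

lemma trail_states: "trail p w q \<Longrightarrow> p # map tgt w = map src w @ [q]"
  by (induction w arbitrary: p) auto

lemma trail_iff:
  "w \<noteq> [] \<Longrightarrow> trail p w q \<longleftrightarrow> fst ` set w \<subseteq> edges G \<and> src (hd w) = p \<and> tgt (last w) = q \<and>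
     (\<forall>i. Suc i < length w \<longrightarrow> tgt (w ! i) = src (w ! Suc i))"
proof (induction w arbitrary: p)
  case (Cons d w)
  show ?case
  proof (cases w)
    case (Cons d' w')
    have "(\<forall>i. Suc i < length (d # w) \<longrightarrow> tgt ((d # w) ! i) = src ((d # w) ! Suc i)) \<longleftrightarrow>
       tgt d = src d' \<and> (\<forall>i. Suc i < length w \<longrightarrow> tgt (w ! i) = src (w ! Suc i))"
      (is "(\<forall>i. ?P i) \<longleftrightarrow> _")
    proof -
      have "(\<forall>i. ?P i) \<longleftrightarrow> ?P 0 \<and> (\<forall>i. ?P (Suc i))"
        by (metis not0_implies_Suc)
      then show ?thesis
        by (simp add: Cons)
    qed
    then show ?thesis
      using Cons.IH Cons by auto
  qed auto
qed auto

text \<open>By \<open>snd_tgt\<close>, a positive edge keeps the value of the state and a negative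
  one changes it. Returning to the initial state therefore means sign +1.\<close>

lemma trail_sign: "trail p w q \<Longrightarrow> snd q = snd p * walk_sign G w"
proof (induction w arbitrary: p)
  case (Cons d w)
  then have "snd q = esign G (fst d) * snd (src d) * walk_sign G w"
    using Cons.IH[of "tgt d"] snd_tgt[of d] by simp
  then show ?case
    using Cons.prems by (auto simp: walk_sign_def)
qed (auto simp: walk_sign_def)

definition circuit :: "('e \<times> bool) list \<Rightarrow> bool" where
  "circuit w \<longleftrightarrow> w \<noteq> [] \<and> (\<exists>p. trail p w p)"

text \<open>Comparing edges without directions suffices here because every circuit is directed by
  the same \<omega>.\<close>

definition minimal_circuit :: "('e \<times> bool) list \<Rightarrow> bool" where
  "minimal_circuit w \<longleftrightarrow> circuit w \<and>
     (\<forall>w'. circuit w' \<longrightarrow> \<not> mset (map fst w') \<subset># mset (map fst w))"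

section \<open>Directed Eulerian walks as circuits\<close>

lemma circuit_imp_directed_eulerian_walk:
  assumes "circuit w"
  shows "directed_eulerian_walk G w (dir_of \<omega> w)"
proof -
  obtain p where w: "w \<noteq> []" and p: "trail p w p"
    using assms by (auto simp: circuit_def)
  have E: "fst ` set w \<subseteq> edges G"
    using trail_edges[OF p] .
  have nth_E: "fst (w ! i) \<in> edges G" if "i < length w" for i
    using E that by (metis image_eqI in_mono nth_mem)
  have closed: "closed_walk G w"
    using w E trail_route[OF p] by (auto simp: closed_walk_iff_route)
  have step: "tgt (w ! i) = src (w ! Suc i)" if "Suc i < length w" for i
    using p trail_iff[OF w] that by auto
  have wrap: "tgt (last w) = src (hd w)"
    using p trail_iff[OF w] by auto
  have last_w: "w ! (length w - 1) = last w" and hd_w: "w ! 0 = hd w"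
    using w by (auto simp: last_conv_nth hd_conv_nth)
  have "fst (hd w) \<in> edges G"
    using nth_E[of 0] w hd_w by auto
  then have "snd p = 1 \<or> snd p = - 1"
    using p trail_iff[OF w, of p p] snd_src_values[of "hd w"] by auto
  then have sign: "walk_sign G w = 1"
    using trail_sign[OF p] by auto
  have dir: "direction G w (dir_of \<omega> w)"
    unfolding direction_def dir_of_def
  proof (intro conjI allI impI)
    fix i assume "Suc i < length w"
    then show "\<omega> (fst (w ! i)) (\<not> snd (w ! i)) + \<omega> (fst (w ! Suc i)) (snd (w ! Suc i)) = 0"
      using step[of i] by (auto simp: src_def tgt_def)
  next
    show "\<omega> (fst (w ! 0)) (snd (hd w)) + \<omega> (fst (w ! (length w - 1))) (\<not> snd (last w)) = 0"
      using wrap last_w hd_w by (auto simp: src_def tgt_def)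
  qed (use nth_E omega_values omega_prod' in auto)
  have "coherent w \<delta>" if \<delta>: "direction G w \<delta>" for \<delta>
  proof -
    \<comment> \<open>The global sign by which \<delta> differs from \<omega>. The product rule
      carries it across an edge and the cancellation rule carries it to the next step.\<close>
    define c where "c = \<delta> 0 (snd (w ! 0)) * \<omega> (fst (w ! 0)) (snd (w ! 0))"
    have pm_one: "\<delta> i h = 1 \<or> \<delta> i h = - 1" if "i < length w" for i h
      using \<delta> that by (auto simp: direction_def)
    have other: "\<delta> i (\<not> snd (w ! i)) = c * \<omega> (fst (w ! i)) (\<not> snd (w ! i))"
      if "i < length w" "\<delta> i (snd (w ! i)) = c * \<omega> (fst (w ! i)) (snd (w ! i))" for i
    proof -
      have "\<delta> i (snd (w ! i)) * \<delta> i (\<not> snd (w ! i)) =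
          \<omega> (fst (w ! i)) (snd (w ! i)) * \<omega> (fst (w ! i)) (\<not> snd (w ! i))"
        using \<delta> that(1) omega_prod'[OF nth_E[OF that(1)]] by (auto simp: direction_def)
      then show ?thesis
        using pm_one[OF that(1), of True] pm_one[OF that(1), of False] that
          omega_values[OF nth_E[OF that(1)], of True] omega_values[OF nth_E[OF that(1)], of False]
        by (cases "snd (w ! i)") auto
    qed
    have start: "\<delta> i (snd (w ! i)) = c * \<omega> (fst (w ! i)) (snd (w ! i))" if "i < length w" for i
      using that
    proof (induction i)
      case 0
      then show ?case
        using omega_values[OF nth_E[OF 0], of "snd (w ! 0)"] by (auto simp: c_def)
    next
      case (Suc i)
      have "\<delta> (Suc i) (snd (w ! Suc i)) = - \<delta> i (\<not> snd (w ! i))"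
        using \<delta> Suc.prems by (auto simp: direction_def eq_neg_iff_add_eq_0 add.commute)
      also have "\<dots> = - c * \<omega> (fst (w ! i)) (\<not> snd (w ! i))"
        using other[of i] Suc by auto
      also have "\<dots> = c * \<omega> (fst (w ! Suc i)) (snd (w ! Suc i))"
        using step[OF Suc.prems] by (simp add: src_def tgt_def) (metis mult_minus_right)
      finally show ?case .
    qed
    have "\<delta> i h = c * \<omega> (fst (w ! i)) h" if "i < length w" for i h
      using start[OF that] other[OF that start[OF that]] by (cases "h = snd (w ! i)") auto
    then show ?thesis
      by (auto simp: coherent_def)
  qed
  then show ?thesis
    using closed sign dir by (auto simp: directed_eulerian_walk_def eulerian_walk_def)
qed

lemma directed_eulerian_walk_imp_circuit:
  assumes "directed_eulerian_walk G w \<delta>" "\<And>i. i < length w \<Longrightarrow> \<delta> i = \<omega> (fst (w ! i))"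
  shows "circuit w"
proof -
  have closed: "closed_walk G w" and dir: "direction G w \<delta>"
    using assms(1) by (auto simp: directed_eulerian_walk_def eulerian_walk_def)
  have w: "w \<noteq> []" and E: "fst ` set w \<subseteq> edges G"
    using closed by (auto simp: closed_walk_iff_route)
  have hd_last: "\<delta> 0 = \<omega> (fst (hd w))" "\<delta> (length w - 1) = \<omega> (fst (last w))"
    using assms(2)[of 0] assms(2)[of "length w - 1"] w by (auto simp: last_conv_nth hd_conv_nth)
  have "tgt (w ! i) = src (w ! Suc i)" if "Suc i < length w" for i
    using closed dir that assms(2)[of i] assms(2)[of "Suc i"]
    by (auto simp: direction_def closed_walk_def walk_def tgt_def src_def)
  moreover have "tgt (last w) = src (hd w)"
    using closed dir hd_last by (auto simp: direction_def closed_walk_def tgt_def src_def)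
  ultimately show ?thesis
    using trail_iff[OF w, of "src (hd w)" "src (hd w)"] w E unfolding circuit_def by metis
qed

lemma directed_edges_along:
  assumes "\<And>i. i < length w \<Longrightarrow> \<delta> i = \<omega> (fst (w ! i))"
  shows "directed_edges w \<delta> = image_mset (\<lambda>e. (e, \<omega> e)) (mset (map fst w))"
proof -
  have "directed_edges w \<delta> = mset (map (\<lambda>i. (fst (w ! i), \<delta> i)) [0..<length w])"
    by (simp add: directed_edges_def)
  also have "map (\<lambda>i. (fst (w ! i), \<delta> i)) [0..<length w] = map (\<lambda>d. (fst d, \<omega> (fst d))) w"
    using assms by (intro nth_equalityI) auto
  finally show ?thesis
    by (simp add: multiset.map_comp comp_def)
qed

text \<open>Directed edges of \<open>w\<close> carry the values of \<omega>, so a directed Eulerian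
  walk contained in \<open>w\<close> is itself directed by \<omega> and hence a circuit. Forgetting
  directions keeps the containment strict, since images of multisets keep multiplicities.\<close>

lemma minimal_circuit_imp_minimal_directed_eulerian_walk:
  assumes "minimal_circuit w"
  shows "minimal_directed_eulerian_walk G w (dir_of \<omega> w)"
proof -
  have "False" if w': "directed_eulerian_walk G w' \<delta>'"
    and less: "directed_edges w' \<delta>' \<subset># directed_edges w (dir_of \<omega> w)" for w' \<delta>'
  proof -
    have w: "directed_edges w (dir_of \<omega> w) = image_mset (\<lambda>e. (e, \<omega> e)) (mset (map fst w))"
      by (rule directed_edges_along) (simp add: dir_of_def)
    have \<delta>': "\<delta>' i = \<omega> (fst (w' ! i))" if "i < length w'" for i
    proof -
      have "(fst (w' ! i), \<delta>' i) \<in># directed_edges w' \<delta>'"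
        using that by (auto simp: directed_edges_def)
      then have "(fst (w' ! i), \<delta>' i) \<in># directed_edges w (dir_of \<omega> w)"
        using less by (meson mset_subset_eqD subset_mset.less_imp_le)
      then show ?thesis
        by (auto simp: w)
    qed
    have "image_mset fst (directed_edges w' \<delta>') \<subset># image_mset fst (directed_edges w (dir_of \<omega> w))"
      using less by (rule image_mset_subset_mono)
    then have "mset (map fst w') \<subset># mset (map fst w)"
      using directed_edges_along[of w' \<delta>', OF \<delta>'] by (simp add: w multiset.map_comp comp_def)
    moreover have "circuit w'"
      using directed_eulerian_walk_imp_circuit[OF w' \<delta>'] .
    ultimately show False
      using assms by (auto simp: minimal_circuit_def)
  qed
  then show ?thesis
    using assms circuit_imp_directed_eulerian_walk
    by (auto simp: minimal_directed_eulerian_walk_def minimal_circuit_def)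
qed

section \<open>Decomposing flows into circuits\<close>

text \<open>This unifies the cases of \<open>inc_coeff\<close>: the coefficient sums the values of
  \<omega> over the half-edges of the edge at \<open>v\<close>. They add up to twice the value on a
  negative loop and cancel on a positive one.\<close>

lemma inc_coeff_halves:
  assumes "fst d \<in> edges G"
  shows "inc_coeff G \<omega> v (fst d) =
    (if step_tail G d = v then snd (src d) else 0) - (if step_head G d = v then snd (tgt d) else 0)"
  using omega_prod[OF assms] esign_values[OF assms] omega_values[OF assms, of True] omega_values[OF assms, of False]
  by (cases "snd d") (auto simp: inc_coeff_def is_loop_def step_tail_def step_head_def src_def tgt_def)

text \<open>A telescoping sum: each intermediate state enters once as a \<open>tgt\<close> and once
  as a \<open>src\<close>, with opposite signs.\<close>

lemma trail_inc_coeff: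
  "trail p w q \<Longrightarrow> (\<Sum>d\<leftarrow>w. inc_coeff G \<omega> v (fst d)) =
     (if fst p = v then snd p else 0) - (if fst q = v then snd q else 0)"
proof (induction w arbitrary: p)
  case (Cons d w)
  then have "(\<Sum>d\<leftarrow>w. inc_coeff G \<omega> v (fst d)) =
      (if step_head G d = v then snd (tgt d) else 0) - (if fst q = v then snd q else 0)"
    using Cons.IH[of "tgt d"] by simp
  moreover have "fst d \<in> edges G" "p = src d"
    using Cons.prems by auto
  ultimately show ?case
    by (simp add: inc_coeff_halves)
qed auto

lemma trail_flow:
  assumes "trail p w q"
  shows "(\<Sum>e\<in>edges G. inc_coeff G \<omega> v e * int (mult w e)) =
     (if fst p = v then snd p else 0) - (if fst q = v then snd q else 0)"
  using sum_list_mult[OF finite_edges trail_edges[OF assms], of "inc_coeff G \<omega> v"]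
    trail_inc_coeff[OF assms, of v] by simp

lemma trail_length:
  assumes "trail p w q"
  shows "int (length w) = (\<Sum>e\<in>edges G. int (mult w e))"
  using sum_list_mult[OF finite_edges trail_edges[OF assms], of "\<lambda>_. 1"] by (simp add: sum_list_triv)

text \<open>A longest trail within the capacities \<open>g\<close> is closed: otherwise what is left
  of \<open>g\<close> has a surplus at the final vertex, of the sign of the final state, and an edge
  causing it prolongs the trail.\<close>

lemma exists_circuit:
  assumes flow: "integral_flow G \<omega> g" and nonneg: "\<And>e. e \<in> edges G \<Longrightarrow> 0 \<le> g e"
    and "e\<^sub>0 \<in> edges G" "g e\<^sub>0 \<noteq> 0"
  shows "\<exists>w. circuit w \<and> (\<forall>e\<in>edges G. int (mult w e) \<le> g e)"
proof -
  define P where "P w \<longleftrightarrow> w \<noteq> [] \<and> (\<exists>p q. trail p w q) \<and> (\<forall>e\<in>edges G. int (mult w e) \<le> g e)" for w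
  have "P [(e\<^sub>0, True)]"
    using assms(3,4) nonneg by (force simp: P_def mult_def)
  moreover have "length w < Suc (nat (\<Sum>e\<in>edges G. g e))" if "P w" for w
  proof -
    have "int (length w) \<le> (\<Sum>e\<in>edges G. g e)"
      using that trail_length sum_mono[of "edges G" "\<lambda>e. int (mult w e)" g] unfolding P_def by metis
    then show ?thesis
      by linarith
  qed
  ultimately obtain w where w: "P w" and max: "\<And>w'. P w' \<Longrightarrow> length w' \<le> length w"
    using ex_has_greatest_nat[of P _ length] by metis
  obtain p q where pq: "trail p w q" and "w \<noteq> []"
    using w by (auto simp: P_def)
  have q_tgt: "q = tgt (last w)" and p_src: "p = src (hd w)" and E: "fst ` set w \<subseteq> edges G"
    using trail_iff[OF \<open>w \<noteq> []\<close>] pq by auto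
  have last_E: "fst (last w) \<in> edges G" "fst (hd w) \<in> edges G"
    using E \<open>w \<noteq> []\<close> by auto
  then have "fst (flip (last w)) \<in> edges G"
    by simp
  then have q: "fst q \<in> verts G" "snd q = 1 \<or> snd q = - 1"
    using step_tail_verts[of "flip (last w)"] snd_src_values[of "flip (last w)"] q_tgt by auto
  have p_values: "snd p = 1 \<or> snd p = - 1"
    using snd_src_values[OF last_E(2)] p_src by auto
  have "p = q"
  proof (rule ccontr)
    assume "p \<noteq> q"
    define r where "r e = g e - int (mult w e)" for e
    have "(\<Sum>e\<in>edges G. inc_coeff G \<omega> (fst q) e * r e) =
        (\<Sum>e\<in>edges G. inc_coeff G \<omega> (fst q) e * g e) - (\<Sum>e\<in>edges G. inc_coeff G \<omega> (fst q) e * int (mult w e))"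
      by (simp add: r_def algebra_simps sum_subtractf)
    also have "\<dots> = snd q - (if fst p = fst q then snd p else 0)"
      using flow q(1) trail_flow[OF pq, of "fst q"] by (auto simp: integral_flow_def)
    \<comment> \<open>After multiplication by \<open>snd q\<close> the right-hand side is 1 if
      \<open>p\<close> and \<open>q\<close> lie at different vertices, and 2 if they differ only in
      their value.\<close>
    finally have "snd q * (\<Sum>e\<in>edges G. inc_coeff G \<omega> (fst q) e * r e) > 0"
      using q(2) p_values \<open>p \<noteq> q\<close> by (auto simp: prod_eq_iff)
    then have "(\<Sum>e\<in>edges G. snd q * (inc_coeff G \<omega> (fst q) e * r e)) > 0"
      by (simp add: sum_distrib_left)
    then obtain e where e: "e \<in> edges G" "snd q * (inc_coeff G \<omega> (fst q) e * r e) > 0"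
      using sum_nonpos by (metis (no_types, lifting) linorder_not_less)
    have r: "r e \<ge> 0"
      using w e(1) by (auto simp: P_def r_def)
    with e(2) have "r e > 0"
      by (cases "r e = 0") auto
    then have "snd q * inc_coeff G \<omega> (fst q) e > 0"
      using e(2) by (simp add: mult.assoc[symmetric] zero_less_mult_iff)
    \<comment> \<open>A coefficient of the sign of \<open>snd q\<close> must come from a half-edge
      with this value at the final vertex, and the trail can leave through it.\<close>
    then have "src (e, True) = q \<or> src (e, False) = q"
      using inc_coeff_halves[of "(e, True)" "fst q"] e(1) q(2) omega_values[OF e(1), of True] omega_values[OF e(1), of False]
      by (auto simp: src_def tgt_def step_tail_def step_head_def prod_eq_iff split: if_splits)
    then obtain h where h: "src (e, h) = q"
      by auto
    have "trail q [(e, h)] (tgt (e, h))"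
      using h e(1) by simp
    then have "trail p (w @ [(e, h)]) (tgt (e, h))"
      using pq unfolding trail_append by blast
    moreover have "int (mult (w @ [(e, h)]) e') \<le> g e'" if "e' \<in> edges G" for e'
      using w \<open>r e > 0\<close> that by (auto simp: P_def r_def mult_def)
    ultimately have "P (w @ [(e, h)])"
      unfolding P_def by blast
    then show False
      using max by fastforce
  qed
  then show ?thesis
    using w pq unfolding P_def circuit_def by blast
qed

text \<open>A shortest circuit below \<open>g\<close> is minimal among all circuits, because a
  circuit contained in it is also below \<open>g\<close>.\<close>

lemma exists_minimal_circuit:
  assumes "integral_flow G \<omega> g" "\<And>e. e \<in> edges G \<Longrightarrow> 0 \<le> g e" "e\<^sub>0 \<in> edges G" "g e\<^sub>0 \<noteq> 0"
  shows "\<exists>w. minimal_circuit w \<and> (\<forall>e\<in>edges G. int (mult w e) \<le> g e)"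
proof -
  define P where "P w \<longleftrightarrow> circuit w \<and> (\<forall>e\<in>edges G. int (mult w e) \<le> g e)" for w
  have "\<exists>w. P w"
    using exists_circuit[OF assms] by (auto simp: P_def)
  then obtain w where w: "P w" and min: "\<And>w'. P w' \<Longrightarrow> length w \<le> length w'"
    using ex_has_least_nat[of P _ length] by metis
  have "\<not> mset (map fst w') \<subset># mset (map fst w)" if "circuit w'" for w'
  proof
    assume less: "mset (map fst w') \<subset># mset (map fst w)"
    then have "mult w' e \<le> mult w e" for e
      unfolding mult_def by (meson mset_subset_eq_count subset_mset.less_imp_le)
    then have "P w'"
      using w that unfolding P_def by (meson of_nat_le_iff order_trans)
    moreover have "length w' < length w"
      using mset_subset_size[OF less] by simp
    ultimately show False
      using min by fastforce
  qed
  then show ?thesis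
    using w by (auto simp: P_def minimal_circuit_def)
qed

lemma circuit_flow:
  assumes "circuit w"
  shows "integral_flow G \<omega> (\<lambda>e. int (mult w e))"
  using assms trail_flow by (auto simp: circuit_def integral_flow_def)

lemma integral_flow_diff:
  "integral_flow G \<omega> f \<Longrightarrow> integral_flow G \<omega> g \<Longrightarrow> integral_flow G \<omega> (\<lambda>e. f e - g e)"
  by (simp add: integral_flow_def right_diff_distrib sum_subtractf)

lemma circuit_mult_pos:
  assumes "circuit w"
  shows "\<exists>e\<in>edges G. mult w e > 0"
proof -
  obtain p where "w \<noteq> []" "trail p w p"
    using assms by (auto simp: circuit_def)
  then have "fst (hd w) \<in> edges G" "mult w (fst (hd w)) > 0"
    using trail_edges[of p w p] by (auto simp: mult_def)
  then show ?thesis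
    by blast
qed

lemma flow_decomposition:
  assumes "integral_flow G \<omega> g" "\<And>e. e \<in> edges G \<Longrightarrow> 0 \<le> g e"
  shows "\<exists>ws. (\<forall>w\<in>set ws. minimal_circuit w) \<and> (\<forall>e\<in>edges G. g e = (\<Sum>w\<leftarrow>ws. int (mult w e)))"
  using assms
proof (induction "nat (\<Sum>e\<in>edges G. g e)" arbitrary: g rule: less_induct)
  case less
  show ?case
  proof (cases "\<exists>e\<^sub>0\<in>edges G. g e\<^sub>0 \<noteq> 0")
    case False
    then show ?thesis
      by (intro exI[of _ "[]"]) auto
  next
    case True
    then obtain w where w: "minimal_circuit w" "\<forall>e\<in>edges G. int (mult w e) \<le> g e"
      using exists_minimal_circuit less.prems by metis
    define g' where "g' e = g e - int (mult w e)" for e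
    have circ: "circuit w"
      using w by (auto simp: minimal_circuit_def)
    have flow': "integral_flow G \<omega> g'"
      unfolding g'_def using less.prems(1) circuit_flow[OF circ] by (rule integral_flow_diff)
    have nonneg': "0 \<le> g' e" if "e \<in> edges G" for e
      using w that by (auto simp: g'_def)
    obtain e\<^sub>1 where "e\<^sub>1 \<in> edges G" "mult w e\<^sub>1 > 0"
      using circuit_mult_pos[OF circ] by auto
    then have "(\<Sum>e\<in>edges G. g' e) < (\<Sum>e\<in>edges G. g e)"
      using finite_edges by (intro sum_strict_mono_ex1) (auto simp: g'_def)
    moreover have "0 \<le> (\<Sum>e\<in>edges G. g' e)"
      using nonneg' by (rule sum_nonneg)
    ultimately have "nat (\<Sum>e\<in>edges G. g' e) < nat (\<Sum>e\<in>edges G. g e)"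
      by auto
    from less.hyps[OF this flow' nonneg'] obtain ws where
      ws: "\<forall>w\<in>set ws. minimal_circuit w" "\<forall>e\<in>edges G. g' e = (\<Sum>w\<leftarrow>ws. int (mult w e))"
      by auto
    then show ?thesis
      using w by (intro exI[of _ "w # ws"]) (auto simp: g'_def algebra_simps)
  qed
qed

end

section \<open>Decomposing a linear forest into paths\<close>

lemma route_reverse: "route G u c v \<Longrightarrow> route G v (rev (map flip c)) u"
  by (induction c arbitrary: u) (auto simp: route_append)

lemma set_path_verts_subset:
  "route G u c v \<Longrightarrow> c \<noteq> [] \<Longrightarrow> set (u # map (step_head G) c) \<subseteq> edge_verts G (fst ` set c)"
  by (cases c) (auto intro: step_tail_in_edge_verts step_head_in_edge_verts)

lemma edge_verts_route:
  "route G u c v \<Longrightarrow> edge_verts G (fst ` set c) \<subseteq> set (u # map (step_head G) c)"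
proof (induction c arbitrary: u)
  case Nil
  then show ?case
    by (simp add: edge_verts_def)
next
  case (Cons d c)
  have "edge_verts G (fst ` set (d # c)) = {step_tail G d, step_head G d} \<union> edge_verts G (fst ` set c)"
  proof -
    have "edge_verts G (fst ` set (d # c)) = range (ends G (fst d)) \<union> edge_verts G (fst ` set c)"
      by (auto simp: edge_verts_def)
    also have "range (ends G (fst d)) = {step_tail G d, step_head G d}"
      by (cases "snd d") (auto simp: step_tail_def step_head_def UNIV_bool)
    finally show ?thesis .
  qed
  then show ?case
    using Cons.IH[of "step_head G d"] Cons.prems by auto
qed

text \<open>The two half-edges are the reversal of the arriving step and the departing step; they
  differ because no edge repeats.\<close>

lemma simple_route_interior:
  assumes "route G a c b" "distinct (map (step_tail G) c @ [b])"
    and "u \<in> set (map (step_tail G) c @ [b])" "u \<noteq> a" "u \<noteq> b"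
  obtains x y where "x \<noteq> y" "fst x \<in> fst ` set c" "fst y \<in> fst ` set c" "step_tail G x = u" "step_tail G y = u"
proof -
  obtain d where d: "d \<in> set c" "step_tail G d = u"
    using assms(3,5) by auto
  then obtain xs ys where c: "c = xs @ d # ys"
    by (metis split_list)
  have "xs \<noteq> []"
    using assms(1,4) c d by auto
  then obtain xs' x where xs: "xs = xs' @ [x]"
    by (metis rev_exhaust)
  have "step_head G x = u"
    using assms(1) c d xs by (auto simp: route_append)
  moreover have "flip x \<noteq> d"
    using simple_route_distinct_edges[OF assms(1,2)] c xs by auto
  ultimately show ?thesis
    using that[of "flip x" d] c xs d by auto
qed

lemma edge_verts_mono: "A \<subseteq> B \<Longrightarrow> edge_verts G A \<subseteq> edge_verts G B"
  by (auto simp: edge_verts_def)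

text \<open>The last two clauses say that both ends of a path are leaves of \<open>M\<close>. They
  later separate the half-edges of \<open>M\<close> at a path end from the remaining ones.\<close>

definition path_decomposition ::
    "('v, 'e) sgraph \<Rightarrow> 'e set \<Rightarrow> ('v \<times> ('e \<times> bool) list) set \<Rightarrow> bool" where
  "path_decomposition G M P \<longleftrightarrow>
     (\<forall>p\<in>P. snd p \<noteq> [] \<and> (\<exists>v. route G (fst p) (snd p) v) \<and> distinct (path_verts G p)) \<and>
     (\<Union>p\<in>P. path_edges p) = M \<and>
     (\<forall>p\<in>P. \<forall>q\<in>P. p \<noteq> q \<longrightarrow> set (path_verts G p) \<inter> set (path_verts G q) = {}) \<and>
     (\<forall>p\<in>P. \<forall>x. fst x \<in> M \<longrightarrow> step_tail G x = fst p \<longrightarrow> x = hd (snd p)) \<and>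
     (\<forall>p\<in>P. \<forall>x. fst x \<in> M \<longrightarrow> step_tail G x = last (path_verts G p) \<longrightarrow> x = flip (last (snd p)))"

text \<open>Another half-edge of \<open>M\<close> at the end \<open>b\<close> would either prolong
  the path or close a cycle inside \<open>M\<close>.\<close>

lemma longest_path_end:
  assumes acyclic: "\<And>C. is_cycle G C \<Longrightarrow> \<not> C \<subseteq> M" and M: "M \<subseteq> edges G"
    and c: "c \<noteq> []" "route G a c b" "distinct (map (step_tail G) c @ [b])" "fst ` set c \<subseteq> M"
    and longest: "\<And>a' c' b'. route G a' c' b' \<Longrightarrow> distinct (map (step_tail G) c' @ [b']) \<Longrightarrow>
      fst ` set c' \<subseteq> M \<Longrightarrow> length c' \<le> length c"
    and x: "fst x \<in> M" "step_tail G x = b"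
  shows "x = flip (last c)"
proof (cases "fst x \<in> fst ` set c")
  case True
  then obtain d where d: "d \<in> set c" "fst x = fst d"
    by auto
  have "x \<noteq> d"
    using c(3) d x(2) by auto
  then have x_flip: "x = flip d"
    using eq_or_flip[OF d(2)] by auto
  have verts: "a # map (step_head G) c = map (step_tail G) c @ [b]"
    using route_verts[OF c(2)] .
  then have "inj_on (step_head G) (set c)"
    using c(3) by (metis distinct.simps(2) distinct_map)
  moreover have "step_head G (last c) = step_head G d"
    using c(1,2) x(2) x_flip by (simp add: route_iff)
  ultimately have "d = last c"
    using d(1) c(1) by (metis inj_onD last_in_set)
  then show ?thesis
    using x_flip by simp
next
  case False
  show ?thesis
  proof (cases "step_head G x \<in> set (map (step_tail G) c @ [b])")
    case True
    \<comment> \<open>The witness is the final part of \<open>c\<close> from the head of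
      \<open>x\<close> to \<open>b\<close>, empty if \<open>x\<close> is a loop. Together with
      \<open>x\<close> it forms a cycle.\<close>
    have "\<exists>c'. route G (step_head G x) c' b \<and> set c' \<subseteq> set c \<and> distinct (map (step_tail G) c' @ [b])"
    proof (cases "step_head G x = b")
      case True
      then show ?thesis
        by (intro exI[of _ "[]"]) auto
    next
      case False
      then obtain d where d: "d \<in> set c" "step_tail G d = step_head G x"
        using True by auto
      then obtain xs ys where "c = xs @ d # ys"
        by (metis split_list)
      then show ?thesis
        using c(2,3) d by (intro exI[of _ "d # ys"]) (auto simp: route_append)
    qed
    then obtain c' where c': "route G (step_head G x) c' b" "set c' \<subseteq> set c" "distinct (map (step_tail G) c' @ [b])"
      by auto
    have c'_M: "fst ` set (x # c') \<subseteq> M"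
      using image_mono[OF c'(2), of fst] c(4) x(1) by auto
    then have "cycle_walk G (x # c')"
      using c' x False M by (intro cycle_walk_of_simple_route) auto
    then have "is_cycle G (fst ` set (x # c'))"
      unfolding is_cycle_iff by blast
    with c'_M show ?thesis
      using acyclic by blast
  next
    case outside: False
    have "route G a (c @ [x]) (step_head G x)"
      using c(2) x(2) by (auto simp: route_append)
    then have "length (c @ [x]) \<le> length c"
      using longest[of a "c @ [x]" "step_head G x"] c(3,4) x outside by auto
    then show ?thesis
      by simp
  qed
qed

text \<open>The hypothesis on three half-edges bounds degrees by two, a loop counting twice, so
  \<open>M\<close> is a linear forest. A longest path is then a whole component, and it is split off
  by induction.\<close>

lemma exists_path_decomposition:
  fixes G :: "('v, 'e) sgraph"
  assumes "finite M" "M \<subseteq> edges G"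
    and "\<And>x y z. fst x \<in> M \<Longrightarrow> fst y \<in> M \<Longrightarrow> fst z \<in> M \<Longrightarrow> step_tail G y = step_tail G x \<Longrightarrow>
      step_tail G z = step_tail G x \<Longrightarrow> x = y \<or> y = z \<or> x = z"
    and "\<And>C. is_cycle G C \<Longrightarrow> \<not> C \<subseteq> M"
  shows "\<exists>P. path_decomposition G M P"
  using assms
proof (induction "card M" arbitrary: M rule: less_induct)
  case less
  show ?case
  proof (cases "M = {}")
    case True
    then show ?thesis
      by (intro exI[of _ "{}"]) (auto simp: path_decomposition_def)
  next
    case False
    then obtain e where e: "e \<in> M"
      by auto
    define Q where "Q = (\<lambda>(a, c, b). route G a c b \<and> distinct (map (step_tail G) c @ [b]) \<and> fst ` set c \<subseteq> M)"
    define len :: "'v \<times> ('e \<times> bool) list \<times> 'v \<Rightarrow> nat" where "len = (\<lambda>(a, c, b). length c)"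
    have "len q < Suc (card M)" if "Q q" for q
    proof -
      obtain a c b where q: "q = (a, c, b)"
        by (cases q)
      have "distinct (map fst c)"
        using that simple_route_distinct_edges[of G a c b] by (auto simp: Q_def q)
      then have "length c = card (fst ` set c)"
        by (metis distinct_card length_map list.set_map)
      also have "\<dots> \<le> card M"
        using that less.prems(1) by (intro card_mono) (auto simp: Q_def q)
      finally show ?thesis
        by (simp add: len_def q)
    qed
    moreover have loop: "step_tail G (e, True) \<noteq> step_head G (e, True)"
    proof
      assume "step_tail G (e, True) = step_head G (e, True)"
      then have "cycle_walk G [(e, True)]"
        using e less.prems(2) by (intro cycle_walk_of_simple_route) auto
      then have "is_cycle G (fst ` set [(e, True)])"
        unfolding is_cycle_iff by blast
      then show False
        using less.prems(4)[of "{e}"] e by simp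
    qed
    have single: "Q (step_tail G (e, True), [(e, True)], step_head G (e, True))"
      using e loop by (auto simp: Q_def)
    ultimately obtain q where q: "Q q" "\<And>q'. Q q' \<Longrightarrow> len q' \<le> len q"
      using ex_has_greatest_nat[of Q _ len] by metis
    obtain a c b where abc: "q = (a, c, b)"
      by (cases q)
    have c: "route G a c b" "distinct (map (step_tail G) c @ [b])" "fst ` set c \<subseteq> M"
      using q(1) by (auto simp: abc Q_def)
    have "c \<noteq> []"
      using q(2)[OF single] by (auto simp: len_def abc)
    have longest: "length c' \<le> length c"
      if "route G a' c' b'" "distinct (map (step_tail G) c' @ [b'])" "fst ` set c' \<subseteq> M" for a' c' b'
      using q(2)[of "(a', c', b')"] that by (auto simp: Q_def len_def abc)
    have verts: "a # map (step_head G) c = map (step_tail G) c @ [b]"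
      using route_verts[OF c(1)] .
    have end_b: "x = flip (last c)" if "fst x \<in> M" "step_tail G x = b" for x
      using longest_path_end[OF less.prems(4,2) \<open>c \<noteq> []\<close> c longest that] .
    have end_a: "x = hd c" if "fst x \<in> M" "step_tail G x = a" for x
    proof -
      \<comment> \<open>The initial vertex is the final one of the reversed path, which is also
        longest.\<close>
      have "x = flip (last (rev (map flip c)))"
      proof (rule longest_path_end[OF less.prems(4,2)])
        show "route G b (rev (map flip c)) a"
          using c(1) by (rule route_reverse)
        have "distinct (rev (a # map (step_head G) c))"
          using c(2) verts by (metis distinct_rev)
        then show "distinct (map (step_tail G) (rev (map flip c)) @ [a])"
          by (simp add: rev_map comp_def)
        show "fst ` set (rev (map flip c)) \<subseteq> M"
          using c(3) by (auto simp: image_image)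
      qed (use that longest \<open>c \<noteq> []\<close> in auto)
      then show ?thesis
        using \<open>c \<noteq> []\<close> by (simp add: last_rev hd_map)
    qed
    define M' where "M' = M - fst ` set c"
    \<comment> \<open>The ends meet no other edge of \<open>M\<close>, and an inner vertex already
      has its two half-edges on the path.\<close>
    have apart: "edge_verts G M' \<inter> set (a # map (step_head G) c) = {}"
    proof -
      have False if x: "fst x \<in> M'" "step_tail G x \<in> set (a # map (step_head G) c)" for x
      proof -
        have x_M: "fst x \<in> M" "fst x \<notin> fst ` set c"
          using x(1) by (auto simp: M'_def)
        then have "step_tail G x \<noteq> a" "step_tail G x \<noteq> b"
          using end_a[of x] end_b[of x] \<open>c \<noteq> []\<close> by auto
        moreover have "step_tail G x \<in> set (map (step_tail G) c @ [b])"
          using x(2) unfolding verts .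
        ultimately obtain y z where "y \<noteq> z" "fst y \<in> fst ` set c" "fst z \<in> fst ` set c"
            "step_tail G y = step_tail G x" "step_tail G z = step_tail G x"
          using simple_route_interior[OF c(1,2), of "step_tail G x"] by blast
        moreover from this have "x = y \<or> y = z \<or> x = z"
          using less.prems(3)[of x y z] x_M c(3) by auto
        ultimately show False
          using x_M by auto
      qed
      then show ?thesis
        unfolding disjoint_iff mem_edge_verts_iff by blast
    qed
    have "card M' < card M"
    proof (rule psubset_card_mono[OF less.prems(1)])
      have "fst (hd c) \<in> fst ` set c"
        using \<open>c \<noteq> []\<close> by simp
      then show "M' \<subset> M"
        using c(3) unfolding M'_def by blast
    qed
    then obtain P where P: "path_decomposition G M' P"
    proof (rule less.hyps[of M', THEN exE])
      show "finite M'" "M' \<subseteq> edges G"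
        using less.prems(1,2) by (auto simp: M'_def)
      show "x = y \<or> y = z \<or> x = z"
        if "fst x \<in> M'" "fst y \<in> M'" "fst z \<in> M'" "step_tail G y = step_tail G x" "step_tail G z = step_tail G x"
        for x y z
        using less.prems(3)[of x y z] that by (auto simp: M'_def)
      show "\<not> C \<subseteq> M'" if "is_cycle G C" for C
        using less.prems(4)[OF that] by (auto simp: M'_def)
    qed
    note P_props = P[unfolded path_decomposition_def]
    have P_verts: "set (path_verts G p) \<subseteq> edge_verts G M'" if p: "p \<in> P" for p
    proof -
      have "(\<Union>p\<in>P. fst ` set (snd p)) = M'"
        using P_props by (simp add: path_edges_def)
      then have "fst ` set (snd p) \<subseteq> M'"
        using that by auto
      moreover obtain v where "snd p \<noteq> []" "route G (fst p) (snd p) v"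
        using P_props[THEN conjunct1] p by auto
      ultimately show ?thesis
        using set_path_verts_subset[of G "fst p" "snd p" v] edge_verts_mono[of "fst ` set (snd p)" M' G]
        by (auto simp: path_verts_def)
    qed
    have P_ends: "fst p \<in> set (path_verts G p)" "last (path_verts G p) \<in> set (path_verts G p)" for p
      using last_in_set[of "path_verts G p"] by (simp_all add: path_verts_def del: last_in_set last.simps)
    have outside: "fst x \<in> M'" if "fst x \<in> M" "p \<in> P" "step_tail G x \<in> set (path_verts G p)" for x p
    proof (rule ccontr)
      assume "fst x \<notin> M'"
      then have "fst x \<in> fst ` set c"
        using that(1) by (auto simp: M'_def)
      then have "step_tail G x \<in> set (a # map (step_head G) c)"
        using step_tail_in_edge_verts edge_verts_route[OF c(1)] by blast
      then show False
        using apart P_verts[OF that(2)] that(3) by auto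
    qed
    have "path_decomposition G M (insert (a, c) P)"
      unfolding path_decomposition_def
    proof (intro conjI)
      show "\<forall>p\<in>insert (a, c) P. snd p \<noteq> [] \<and> (\<exists>v. route G (fst p) (snd p) v) \<and> distinct (path_verts G p)"
      proof -
        have "distinct (a # map (step_head G) c)"
          unfolding verts by (rule c(2))
        then show ?thesis
          using P_props[THEN conjunct1] c(1) \<open>c \<noteq> []\<close> unfolding path_verts_def by force
      qed
      show "(\<Union>p\<in>insert (a, c) P. path_edges p) = M"
        using P_props[THEN conjunct2, THEN conjunct1] c(3) by (auto simp: path_edges_def M'_def)
      show "\<forall>p\<in>insert (a, c) P. \<forall>q\<in>insert (a, c) P. p \<noteq> q \<longrightarrow> set (path_verts G p) \<inter> set (path_verts G q) = {}"
      proof -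
        have "set (path_verts G (a, c)) \<inter> set (path_verts G p) = {}" if "p \<in> P" for p
          using P_verts[OF that] apart by (auto simp: path_verts_def)
        then show ?thesis
          using P_props[THEN conjunct2, THEN conjunct2, THEN conjunct1] by auto
      qed
      show "\<forall>p\<in>insert (a, c) P. \<forall>x. fst x \<in> M \<longrightarrow> step_tail G x = fst p \<longrightarrow> x = hd (snd p)"
      proof (intro ballI allI impI)
        fix p x assume p: "p \<in> insert (a, c) P" "fst x \<in> M" "step_tail G x = fst p"
        show "x = hd (snd p)"
        proof (cases "p \<in> P")
          case True
          then have "fst x \<in> M'"
            using outside[OF p(2) True] p(3) P_ends(1)[of p] by simp
          then show ?thesis
            using P_props[THEN conjunct2, THEN conjunct2, THEN conjunct2, THEN conjunct1, THEN bspec, OF True] p(3) by blast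
        qed (use p end_a in auto)
      qed
      have last_b: "last (path_verts G (a, c)) = b"
        unfolding path_verts_def fst_conv snd_conv verts by simp
      show "\<forall>p\<in>insert (a, c) P. \<forall>x. fst x \<in> M \<longrightarrow> step_tail G x = last (path_verts G p) \<longrightarrow> x = flip (last (snd p))"
      proof (intro ballI allI impI)
        fix p x assume p: "p \<in> insert (a, c) P" "fst x \<in> M" "step_tail G x = last (path_verts G p)"
        show "x = flip (last (snd p))"
        proof (cases "p \<in> P")
          case True
          then have "fst x \<in> M'"
            using outside[OF p(2) True] p(3) P_ends(2)[of p] by simp
          then show ?thesis
            using P_props[THEN conjunct2, THEN conjunct2, THEN conjunct2, THEN conjunct2, THEN bspec, OF True] p(3) by blast
        next
          case False
          then have "p = (a, c)"
            using p(1) by simp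
          then show ?thesis
            using end_b[OF p(2)] p(3) last_b by simp
        qed
      qed
    qed
    then show ?thesis
      by blast
  qed
qed

section \<open>Connectedness and cut-points\<close>

lemma connected_walk_subgraph:
  assumes "route G u w v" "w \<noteq> []"
  shows "connected_sgraph (walk_subgraph G w)"
proof -
  define T where "T = walk_subgraph G w"
  define S where "S = cells T"
  define R where "R = (touching T \<union> (touching T)\<inverse>) \<inter> S \<times> S"
  have T: "ends T = ends G" "edges T = fst ` set w" "verts T = edge_verts G (fst ` set w)"
    by (auto simp: T_def walk_subgraph_def)
  have "sym R"
    by (auto simp: R_def sym_def)
  then have sym: "sym (R\<^sup>*)"
    by (rule sym_rtrancl)
  have touch: "(Inr (fst d), Inl (step_tail G d)) \<in> R" "(Inl (step_tail G d), Inr (fst d)) \<in> R"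
    if "fst d \<in> fst ` set w" for d
  proof -
    have "(Inl (step_tail G d), Inr (fst d)) \<in> touching T"
      using that by (auto simp: touching_def T step_tail_def)
    moreover have "Inl (step_tail G d) \<in> S" "Inr (fst d) \<in> S"
      using that step_tail_in_edge_verts[OF that, of G] by (auto simp: S_def cells_def T)
    ultimately show "(Inr (fst d), Inl (step_tail G d)) \<in> R" "(Inl (step_tail G d), Inr (fst d)) \<in> R"
      by (auto simp: R_def)
  qed
  have along: "(Inl z, Inr (fst d)) \<in> R\<^sup>*" if "route G z c z'" "d \<in> set c" "set c \<subseteq> set w" for z z' c d
    using that
  proof (induction c arbitrary: z)
    case (Cons d' c)
    have z: "step_tail G d' = z"
      using Cons.prems(1) by auto
    have d': "(Inl z, Inr (fst d')) \<in> R\<^sup>*"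
      using touch(2)[of d'] z Cons.prems(3) by auto
    moreover have "(Inr (fst d'), Inl (step_head G d')) \<in> R"
      using touch(1)[of "flip d'"] Cons.prems(3) by auto
    ultimately have "(Inl z, Inl (step_head G d')) \<in> R\<^sup>*"
      by auto
    then show ?case
      using Cons.IH[of "step_head G d'"] Cons.prems d' by (auto intro: rtrancl_trans)
  qed auto
  have reach: "(Inl u, x) \<in> R\<^sup>*" if x: "x \<in> S" for x
  proof -
    have edge: "(Inl u, Inr e) \<in> R\<^sup>*" if "e \<in> fst ` set w" for e
      using that along[OF assms(1)] by auto
    show ?thesis
    proof (cases x)
      case (Inl v)
      then have "v \<in> edge_verts G (fst ` set w)"
        using x by (auto simp: S_def cells_def T)
      then obtain y where "fst y \<in> fst ` set w" "step_tail G y = v"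
        unfolding mem_edge_verts_iff by blast
      then show ?thesis
        using edge[of "fst y"] touch(1)[of y] Inl by auto
    next
      case (Inr e)
      then show ?thesis
        using edge[of e] x by (auto simp: S_def cells_def T)
    qed
  qed
  have rel: "component_rel T S = S \<times> S"
  proof -
    have "(x, y) \<in> R\<^sup>*" if "x \<in> S" "y \<in> S" for x y
      using reach[OF that(1)] reach[OF that(2)] sym by (meson rtrancl_trans symD)
    then show ?thesis
      by (auto simp: component_rel_def R_def)
  qed
  have "S \<noteq> {}"
    using assms(2) by (auto simp: S_def cells_def T)
  then have "S // component_rel T S = {S}"
    by (auto simp: rel quotient_def)
  then show ?thesis
    by (simp add: connected_sgraph_def num_components_def T_def[symmetric] S_def)
qed

text \<open>Without \<open>u\<close>, the cells of \<open>A\<close> and its vertices, the set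
  \<open>K\<close>, cannot be left by touching. The two components are told apart by an edge of
  \<open>A\<close> and an edge of \<open>B\<close>, which also covers a side consisting of a single
  loop at \<open>u\<close>.\<close>

lemma cut_point_of_separation:
  assumes "signed_graph T" "connected_sgraph T" "u \<in> verts T"
    and "edges T = A \<union> B" "A \<inter> B = {}" "A \<noteq> {}" "B \<noteq> {}"
    and "edge_verts T A \<inter> edge_verts T B \<subseteq> {u}"
  shows "cut_point T u"
proof -
  define S where "S = cells T - {Inl u}"
  define R where "R = (touching T \<union> (touching T)\<inverse>) \<inter> S \<times> S"
  define K where "K = Inr ` A \<union> Inl ` edge_verts T A"
  obtain a b where ab: "a \<in> A" "b \<in> B"
    using assms(6,7) by auto
  then have "b \<notin> A"
    using assms(5) by auto
  have in_S: "Inr a \<in> S" "Inr b \<in> S"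
    using ab assms(4) by (auto simp: S_def cells_def)
  have step: "y \<in> K" if "(x, y) \<in> R" "x \<in> K" for x y
  proof -
    have "y \<in> K" if "(x, y) \<in> touching T \<inter> S \<times> S" "x \<in> K" for x y
    proof -
      obtain e h where e: "x = Inl (ends T e h)" "y = Inr e" "e \<in> edges T"
        using \<open>(x, y) \<in> touching T \<inter> S \<times> S\<close> by (auto simp: touching_def)
      have "ends T e h \<in> edge_verts T A" "ends T e h \<noteq> u"
        using that e by (auto simp: K_def S_def)
      moreover have "ends T e h \<in> edge_verts T B" if "e \<in> B"
        using that by (auto simp: edge_verts_def)
      ultimately show ?thesis
        using assms(4,8) e by (auto simp: K_def)
    qed
    moreover have "y \<in> K" if "(y, x) \<in> touching T" "x \<in> K" for x y
      using that by (auto simp: touching_def K_def edge_verts_def)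
    ultimately show ?thesis
      using that by (auto simp: R_def)
  qed
  have "y \<in> K" if "(Inr a, y) \<in> R\<^sup>*" for y
    using that by (induction rule: rtrancl_induct) (use ab step in \<open>auto simp: K_def\<close>)
  then have "(Inr a, Inr b) \<notin> R\<^sup>*"
    using \<open>b \<notin> A\<close> by (auto simp: K_def)
  then have "Inr b \<notin> component_rel T S `` {Inr a}" "Inr b \<in> component_rel T S `` {Inr b}"
    using in_S by (auto simp: component_rel_def R_def)
  then have neq: "component_rel T S `` {Inr a} \<noteq> component_rel T S `` {Inr b}"
    by blast
  have "finite S"
    using assms(1) by (auto simp: S_def cells_def signed_graph_def)
  then have "finite (S // component_rel T S)"
    by (rule finite_quotient) (auto simp: component_rel_def)
  then have "card {component_rel T S `` {Inr a}, component_rel T S `` {Inr b}} \<le> num_components T S"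
    unfolding num_components_def using in_S by (intro card_mono) (auto intro: quotientI)
  then have "2 \<le> num_components T S"
    using neq by simp
  then show ?thesis
    using assms(2,3) by (simp add: cut_point_def connected_sgraph_def S_def)
qed

section \<open>Structure of a minimal circuit\<close>

lemma distinct_map_splitI:
  "(\<And>xs d ys. w = xs @ d # ys \<Longrightarrow> f d \<notin> f ` set ys) \<Longrightarrow> distinct (map f w)"
proof (induction w)
  case (Cons a w)
  have "distinct (map f w)"
    using Cons.prems[of "a # _"] by (intro Cons.IH) auto
  moreover have "f a \<notin> f ` set w"
    using Cons.prems[of "[]"] by auto
  ultimately show ?case
    by auto
qed auto

context bidirected_graph
begin

lemma trail_visit:
  assumes "trail p w q" "v \<in> edge_verts G (fst ` set w)"
  shows "\<exists>w1 w2 r. w = w1 @ w2 \<and> trail p w1 r \<and> trail r w2 q \<and> fst r = v"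
proof -
  obtain x d where x: "step_tail G x = v" "d \<in> set w" "fst x = fst d"
    using assms(2) by (auto simp: mem_edge_verts_iff)
  then obtain xs ys where w: "w = xs @ d # ys"
    by (metis split_list)
  obtain r where r: "trail p xs r" "trail r (d # ys) q"
    using assms(1) unfolding w trail_append by blast
  then have "trail r [d] (tgt d)"
    by simp
  then have "trail p (xs @ [d]) (tgt d)"
    using r(1) unfolding trail_append by blast
  moreover have "w = (xs @ [d]) @ ys" "trail (tgt d) ys q"
    using w r by auto
  moreover have "fst r = step_tail G d"
    using r by auto
  moreover have "x = d \<or> x = flip d"
    using eq_or_flip[OF x(3)] .
  ultimately show ?thesis
    using x(1) w r fst_tgt[of d] flip_simps(6)[of G d] by metis
qed

lemma trail_start_value:
  assumes "trail p w q" "w \<noteq> []"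
  shows "snd p = 1 \<or> snd p = - 1"
  using assms snd_src_values by (cases w) auto

end

locale minimal_bidirected_circuit = bidirected_graph G \<omega>
  for G :: "('v, 'e) sgraph" and \<omega> +
  fixes w :: "('e \<times> bool) list"
  assumes minimal: "minimal_circuit w"
begin

abbreviation walk_edges :: "'e set" where
  "walk_edges \<equiv> fst ` set w"

definition states :: "('v \<times> int) set" where
  "states = src ` set w"

definition double :: "'v \<Rightarrow> bool" where
  "double u \<longleftrightarrow> (u, 1) \<in> states \<and> (u, - 1) \<in> states"

text \<open>Steps of \<open>w\<close> do not repeat (\<open>distinct_w\<close>), so an edge occurs
  twice exactly when it is traversed in both directions; see \<open>mult_w\<close>.\<close>

definition doubled_edges :: "'e set" where
  "doubled_edges = {e. (e, True) \<in> set w \<and> (e, False) \<in> set w}"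

section \<open>States visited by a minimal circuit\<close>

lemma w_nonempty: "w \<noteq> []"
  using minimal by (auto simp: minimal_circuit_def circuit_def)

lemma w_trail: "\<exists>p. trail p w p"
  using minimal unfolding minimal_circuit_def circuit_def by blast

lemma walk_edges_subset: "walk_edges \<subseteq> edges G"
  using w_trail trail_edges by blast

text \<open>With the remainder \<open>Z\<close> explicit, a recombination of parts of
  \<open>w\<close>, some of them reversed, is refuted by one identity of multisets.\<close>

lemma no_proper_subcircuit:
  assumes "trail p c p" "c \<noteq> []" "mset (map fst w) = mset (map fst c) + Z"
  shows "Z = {#}"
proof (rule ccontr)
  assume "Z \<noteq> {#}"
  then have "mset (map fst c) \<subset># mset (map fst w)"
    using assms(3) by (simp add: subset_mset_def)
  moreover have "circuit c"
    using assms(1,2) unfolding circuit_def by blast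
  ultimately show False
    using minimal by (auto simp: minimal_circuit_def)
qed

lemma distinct_src: "distinct (map src w)"
proof (rule distinct_map_splitI)
  fix xs d ys assume w: "w = xs @ d # ys"
  show "src d \<notin> src ` set ys"
  proof
    assume "src d \<in> src ` set ys"
    then obtain d' where d': "d' \<in> set ys" "src d' = src d"
      by auto
    then obtain b c where ys: "ys = b @ d' # c"
      by (metis split_list)
    obtain p where "trail p w p"
      using w_trail by blast
    then have "trail p (xs @ (d # b) @ (d' # c)) p"
      by (simp add: w ys)
    then obtain r r' where "trail r (d # b) r'" "trail r' (d' # c) p"
      unfolding trail_append by blast
    then have "trail (src d) (d # b) (src d)"
      using d'(2) by auto
    then have "mset (map fst (xs @ d' # c)) = {#}"
      by (rule no_proper_subcircuit) (auto simp: w ys)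
    then show False
      by simp
  qed
qed

lemma mset_tgt: "mset (map tgt w) = mset (map src w)"
proof -
  obtain p where "trail p w p"
    using w_trail by blast
  then have "mset (p # map tgt w) = mset (map src w @ [p])"
    using trail_states by metis
  then show ?thesis
    by simp
qed

lemma distinct_tgt: "distinct (map tgt w)"
  using distinct_src mset_tgt by (metis mset_eq_imp_distinct_iff)

lemma distinct_w: "distinct w"
  using distinct_src by (simp add: distinct_map)

lemma inj_src: "x \<in> set w \<Longrightarrow> y \<in> set w \<Longrightarrow> src x = src y \<Longrightarrow> x = y"
  using distinct_src by (auto simp: distinct_map dest: inj_onD)

lemma inj_tgt: "x \<in> set w \<Longrightarrow> y \<in> set w \<Longrightarrow> tgt x = tgt y \<Longrightarrow> x = y"
  using distinct_tgt by (auto simp: distinct_map dest: inj_onD)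

lemma states_tgt: "states = tgt ` set w"
  using mset_tgt unfolding states_def by (metis set_map set_mset_mset)

lemma half_cases: "fst x \<in> walk_edges \<Longrightarrow> x \<in> set w \<or> flip x \<in> set w"
  using eq_or_flip by (metis flip_simps(3) imageE)

lemma src_in_states: "x \<in> set w \<Longrightarrow> src x \<in> states"
  by (simp add: states_def)

lemma opp_src_in_states: "flip x \<in> set w \<Longrightarrow> opp (src x) \<in> states"
  unfolding states_tgt by (metis image_eqI tgt_flip)

lemma states_value: "p \<in> states \<Longrightarrow> snd p = 1 \<or> snd p = - 1"
  using snd_src_values walk_edges_subset unfolding states_def by blast

section \<open>Separation at a vertex passed twice\<close>

lemma doubleI:
  assumes "p \<in> states" "opp p \<in> states"
  shows "double (fst p)"
  using assms states_value[OF assms(1)] by (cases p) (auto simp: double_def opp_def)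

text \<open>A further common vertex cuts the parts into \<open>A1 @ A2\<close> and
  \<open>B1 @ B2\<close>. If both are there in the same state, \<open>A2 @ B1\<close> is closed and
  leaves \<open>A1\<close> and \<open>B2\<close> over. If the states are opposite, the reversal of
  \<open>A1\<close> ends in \<open>opp p = q\<close>, where \<open>B1\<close> starts; both together
  are closed and leave \<open>A2\<close> and \<open>B2\<close> over.\<close>

lemma separation_of_split:
  assumes A: "trail p A q" "A \<noteq> []" and B: "trail q B p" "B \<noteq> []"
    and pq: "q = opp p" and w: "mset w = mset (A @ B)"
  shows "edge_verts G (fst ` set A) \<inter> edge_verts G (fst ` set B) \<subseteq> {fst p}"
proof
  fix v assume v: "v \<in> edge_verts G (fst ` set A) \<inter> edge_verts G (fst ` set B)"
  obtain A1 A2 r where A12: "A = A1 @ A2" "trail p A1 r" "trail r A2 q" "fst r = v"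
    using trail_visit[OF A(1)] v by blast
  obtain B1 B2 r' where B12: "B = B1 @ B2" "trail q B1 r'" "trail r' B2 p" "fst r' = v"
    using trail_visit[OF B(1)] v by blast
  show "v \<in> {fst p}"
  proof (rule ccontr)
    assume "v \<notin> {fst p}"
    then have neq: "p \<noteq> r" "q \<noteq> r" "p \<noteq> r'" "q \<noteq> r'"
      using A12(4) B12(4) pq by auto
    then have ne: "A1 \<noteq> []" "A2 \<noteq> []" "B1 \<noteq> []" "B2 \<noteq> []"
      using A12 B12 by auto
    have "snd r = 1 \<or> snd r = - 1" "snd r' = 1 \<or> snd r' = - 1"
      using trail_start_value A12(3) B12(3) ne by blast+
    then consider "r' = r" | "r' = opp r"
      using A12(4) B12(4) by (auto simp: prod_eq_iff)
    then show False
    proof cases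
      case 1
      then have "trail r (A2 @ B1) r"
        using A12 B12 unfolding trail_append by blast
      then have "mset (map fst (A1 @ B2)) = {#}"
        by (rule no_proper_subcircuit) (use ne in \<open>auto simp: w A12(1) B12(1)\<close>)
      then show False
        using ne by simp
    next
      case 2
      have "trail (opp r) (rev (map flip A1)) q"
        using trail_reverse[OF A12(2)] pq by simp
      then have "trail r' (rev (map flip A1) @ B1) r'"
        using 2 B12 unfolding trail_append by blast
      then have "mset (map fst (A2 @ B2)) = {#}"
        by (rule no_proper_subcircuit)
          (use ne in \<open>auto simp: w A12(1) B12(1) rev_map[symmetric] multiset.map_comp comp_def\<close>)
      then show False
        using ne by simp
    qed
  qed
qed

lemma split_at_double:
  assumes "p \<in> states" "opp p \<in> states"
  obtains A B where "trail p A (opp p)" "trail (opp p) B p" "A \<noteq> []" "B \<noteq> []" "mset w = mset (A @ B)"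
proof -
  obtain d where d: "d \<in> set w" "src d = p"
    using assms(1) by (auto simp: states_def)
  then obtain xs ys where w: "w = xs @ d # ys"
    by (metis split_list)
  obtain p\<^sub>0 where "trail p\<^sub>0 (xs @ d # ys) p\<^sub>0"
    using w_trail w by auto
  then have t: "trail p (d # ys @ xs) p"
    using d(2) by (auto simp: trail_append simp del: split_paired_Ex)
  obtain d' where d': "d' \<in> set w" "src d' = opp p"
    using assms(2) by (auto simp: states_def)
  have "opp p \<noteq> p"
    using states_value[OF assms(1)] by (auto simp: prod_eq_iff)
  then have "d' \<in> set (ys @ xs)"
    using d' d w by auto
  then obtain as bs where split: "ys @ xs = as @ d' # bs"
    by (metis split_list)
  then have "trail p ((d # as) @ (d' # bs)) p"
    using t by simp
  then obtain r where r: "trail p (d # as) r" "trail r (d' # bs) p"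
    unfolding trail_append by blast
  then have "r = opp p"
    using d'(2) by auto
  moreover have "mset w = mset (d # ys @ xs)"
    using w by simp
  then have "mset w = mset ((d # as) @ (d' # bs))"
    using split by simp
  ultimately show ?thesis
    using that[of "d # as" "d' # bs"] r by auto
qed

text \<open>State \<open>p\<close> is left only by the first step of \<open>A\<close>, and
  \<open>opp p\<close> is entered only by its last step, which arrives through a half-edge of value
  \<open>snd p\<close>. These are all the half-edges with this value at the vertex.\<close>

lemma half_in_split:
  assumes "trail p A (opp p)" "A \<noteq> []" "set A \<subseteq> set w" "fst x \<in> walk_edges" "src x = p"
  shows "fst x \<in> fst ` set A"
proof -
  have A: "src (hd A) = p" "tgt (last A) = opp p" "hd A \<in> set A" "last A \<in> set A"
    using assms(1,2) trail_iff[OF assms(2)] by auto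
  consider "x \<in> set w" | "flip x \<in> set w"
    using half_cases[OF assms(4)] by auto
  then show ?thesis
  proof cases
    case 1
    then have "x = hd A"
      using A assms(3,5) by (intro inj_src) auto
    then show ?thesis
      using A by auto
  next
    case 2
    then have "flip x = last A"
      using A assms(3,5) by (intro inj_tgt) auto
    then show ?thesis
      using A by (metis flip_simps(1) image_eqI)
  qed
qed

text \<open>All later arguments use the two parts of the circuit only through these edge sets: the
  value of a half-edge at the vertex decides on which side it lies. It remains to exclude an edge
  common to both parts, which would be a loop there, traversed in both directions.\<close>

lemma sides:
  assumes "p \<in> states" "opp p \<in> states"
  obtains A B where "A \<union> B = walk_edges" "A \<inter> B = {}" "A \<noteq> {}" "B \<noteq> {}"
    "edge_verts G A \<inter> edge_verts G B \<subseteq> {fst p}"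
    "\<And>x. fst x \<in> walk_edges \<Longrightarrow> src x = p \<Longrightarrow> fst x \<in> A"
    "\<And>x. fst x \<in> walk_edges \<Longrightarrow> src x = opp p \<Longrightarrow> fst x \<in> B"
proof -
  obtain A B where A: "trail p A (opp p)" "A \<noteq> []" and B: "trail (opp p) B p" "B \<noteq> []"
    and w: "mset w = mset (A @ B)"
    using split_at_double[OF assms] .
  have set_w: "set w = set A \<union> set B"
    using w by (metis set_append set_mset_mset)
  have verts: "edge_verts G (fst ` set A) \<inter> edge_verts G (fst ` set B) \<subseteq> {fst p}"
    using separation_of_split[OF A B _ w] by simp
  have "mset (map src w) = mset (map src (A @ B))"
    using w by (metis mset_map)
  then have "distinct (map src (A @ B))"
    using distinct_src by (metis mset_eq_imp_distinct_iff)
  then have src_disjoint: "src d \<noteq> src d'" if "d \<in> set A" "d' \<in> set B" for d d'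
    using that by auto
  have disjoint: "fst ` set A \<inter> fst ` set B = {}"
  proof (rule ccontr)
    assume "fst ` set A \<inter> fst ` set B \<noteq> {}"
    then obtain e where "e \<in> fst ` set A" "e \<in> fst ` set B"
      by blast
    then obtain d d' where d: "d \<in> set A" "d' \<in> set B" "fst d' = fst d"
      by (metis imageE)
    have at_p: "step_tail G x = fst p" if "fst x = fst d" for x
    proof -
      have "fst x \<in> fst ` set A" "fst x \<in> fst ` set B"
        using d that by (metis image_eqI)+
      then show ?thesis
        using verts step_tail_in_edge_verts by blast
    qed
    have "d' \<noteq> d"
      using src_disjoint[OF d(1,2)] by auto
    then have d': "d' = flip d"
      using eq_or_flip[OF d(3)] by auto
    have tail: "step_tail G d = fst p" "step_head G d = fst p"
      using at_p[of d] at_p[of "flip d"] by auto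
    have "d \<in> set w" "d' \<in> set w"
      using d set_w by auto
    then have "snd (src d) = 1 \<or> snd (src d) = - 1" "snd (src d') = 1 \<or> snd (src d') = - 1"
      using states_value src_in_states by blast+
    \<comment> \<open>Otherwise the two states of \<open>d\<close> are opposite and
      \<open>flip d\<close> departs in the same state as \<open>d\<close>. So \<open>d\<close> alone
      is a circuit, with \<open>flip d\<close> left over.\<close>
    then have "tgt d = src d"
      using src_disjoint[OF d(1,2)] tail unfolding d' by (auto simp: prod_eq_iff)
    moreover have "fst d \<in> edges G"
      using walk_edges_subset \<open>d \<in> set w\<close> by blast
    ultimately have "trail (src d) [d] (src d)"
      by auto
    moreover have "mset w = mset ([d] @ remove1 d w)"
      using \<open>d \<in> set w\<close> by simp
    then have "mset (map fst w) = mset (map fst [d]) + mset (map fst (remove1 d w))"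
      by (metis map_append mset_append mset_map)
    ultimately have "mset (map fst (remove1 d w)) = {#}"
      by (intro no_proper_subcircuit) auto
    then have "map fst (remove1 d w) = []"
      using mset_zero_iff by blast
    moreover have "d' \<in> set (remove1 d w)"
      using \<open>d' \<in> set w\<close> \<open>d' \<noteq> d\<close> by simp
    ultimately show False
      by auto
  qed
  show ?thesis
  proof (rule that[of "fst ` set A" "fst ` set B"])
    show "fst ` set A \<union> fst ` set B = walk_edges"
      using set_w by (simp add: image_Un)
    show "fst x \<in> fst ` set A" if "fst x \<in> walk_edges" "src x = p" for x
      using half_in_split[OF A _ that] set_w by auto
    show "fst x \<in> fst ` set B" if "fst x \<in> walk_edges" "src x = opp p" for x
      using half_in_split[of "opp p" B x] B that set_w by auto
  qed (use A B verts disjoint in auto)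
qed

section \<open>Half-edges with equal values at a vertex\<close>

lemma half_value: "fst x \<in> walk_edges \<Longrightarrow> snd (src x) = 1 \<or> snd (src x) = - 1"
  using snd_src_values walk_edges_subset by blast

lemma half_src_cases:
  assumes "fst x \<in> walk_edges" "fst y \<in> walk_edges" "step_tail G y = step_tail G x"
  shows "src y = src x \<or> src y = opp (src x)"
  using half_value[OF assms(1)] half_value[OF assms(2)] assms(3) by (auto simp: prod_eq_iff)

lemma double_states:
  assumes "double (step_tail G x)" "fst x \<in> walk_edges"
  shows "src x \<in> states" "opp (src x) \<in> states"
  using assms half_value[OF assms(2)] by (cases "src x"; auto simp: double_def src_def opp_def)+

text \<open>A half-edge of value \<open>s\<close> at \<open>v\<close> serves for departing in state
  \<open>(v, s)\<close> or for arriving in state \<open>(v, -s)\<close>. Each of these happens at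
  most once, so of two such half-edges one serves only for departure and the other only for
  arrival.\<close>

lemma same_src:
  assumes "fst x \<in> walk_edges" "fst y \<in> walk_edges" "src x = src y" "x \<noteq> y"
  shows "x \<in> set w \<and> y \<notin> set w \<and> flip y \<in> set w \<and> flip x \<notin> set w \<or>
         y \<in> set w \<and> x \<notin> set w \<and> flip x \<in> set w \<and> flip y \<notin> set w"
proof -
  have "\<not> (x \<in> set w \<and> y \<in> set w)"
    using inj_src assms(3,4) by blast
  moreover have "\<not> (flip x \<in> set w \<and> flip y \<in> set w)"
    using inj_tgt[of "flip x" "flip y"] assms(3,4) by (metis flip_simps(3) tgt_flip)
  ultimately show ?thesis
    using half_cases[OF assms(1)] half_cases[OF assms(2)] by blast
qed

lemma same_src_double:
  assumes "fst x \<in> walk_edges" "fst y \<in> walk_edges" "src x = src y" "x \<noteq> y"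
  shows "double (step_tail G x)"
proof -
  have "src x \<in> states" "opp (src x) \<in> states"
    using same_src[OF assms] src_in_states opp_src_in_states assms(3) by metis+
  then show ?thesis
    using doubleI by fastforce
qed

text \<open>Among three different half-edges, two would both serve for departure or both for
  arrival.\<close>

lemma same_src_three:
  assumes "fst x \<in> walk_edges" "fst y \<in> walk_edges" "fst z \<in> walk_edges" "src y = src x" "src z = src x"
  shows "x = y \<or> y = z \<or> x = z"
  using same_src[of x y] same_src[of y z] same_src[of x z] assms by metis

lemma doubled_edgesD:
  assumes "fst x \<in> doubled_edges"
  shows "x \<in> set w" "flip x \<in> set w" "fst x \<in> walk_edges" "double (step_tail G x)"
proof -
  have "(fst x, snd x) \<in> set w \<and> (fst x, \<not> snd x) \<in> set w"
    using assms by (cases "snd x") (auto simp: doubled_edges_def)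
  then show w: "x \<in> set w" "flip x \<in> set w"
    by (simp_all add: flip_def)
  then show "fst x \<in> walk_edges"
    by auto
  show "double (step_tail G x)"
    using doubleI[OF src_in_states[OF w(1)] opp_src_in_states[OF w(2)]] by simp
qed

text \<open>A half-edge of a doubled edge takes both the departure and the arrival belonging to its
  value, leaving none for another half-edge.\<close>

lemma doubled_edges_unique:
  assumes "fst x \<in> doubled_edges" "fst y \<in> walk_edges" "src y = src x"
  shows "y = x"
  using same_src[of x y] doubled_edgesD[OF assms(1)] assms by metis

text \<open>\<open>partner x\<close> is the half-edge that follows \<open>x\<close>, at the same vertex, in the block of \<open>x\<close>.\<close>

definition partner :: "'e \<times> bool \<Rightarrow> 'e \<times> bool \<Rightarrow> bool" where
  "partner x y \<longleftrightarrow> fst x \<in> walk_edges \<and> fst y \<in> walk_edges \<and> x \<noteq> y \<and>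
     src y = (if double (step_tail G x) then src x else opp (src x))"

lemma partner_tail: "partner x y \<Longrightarrow> step_tail G y = step_tail G x"
  unfolding partner_def by (metis fst_src opp_simps(1))

lemma partner_sym: "partner x y \<Longrightarrow> partner y x"
  using partner_tail[of x y] by (auto simp: partner_def)

text \<open>At a double vertex a third half-edge of the same value is excluded by
  \<open>same_src_three\<close>; elsewhere, two half-edges of the value opposite to that of
  \<open>x\<close> would make the vertex double.\<close>

lemma partner_unique:
  assumes "partner x y" "partner x z"
  shows "y = z"
proof (rule ccontr)
  assume "y \<noteq> z"
  moreover have "src y = src z"
    using assms by (simp add: partner_def)
  ultimately have "double (step_tail G y)"
    using same_src_double[of y z] assms by (simp add: partner_def)
  then have "double (step_tail G x)"
    using partner_tail[OF assms(1)] by simp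
  then show False
    using assms same_src_three[of x y z] \<open>y \<noteq> z\<close> by (simp add: partner_def)
qed

section \<open>Cycles within the circuit\<close>

definition cycles :: "'e set set" where
  "cycles = {C. is_cycle G C \<and> C \<subseteq> walk_edges}"

lemma cyclesE:
  assumes "C \<in> cycles"
  obtains c where "cycle_walk G c" "C = fst ` set c" "C \<subseteq> walk_edges"
  using assms by (auto simp: cycles_def is_cycle_iff)

lemma cycles_one_side:
  assumes "C \<in> cycles" "A \<union> B = walk_edges" "A \<inter> B = {}" "edge_verts G A \<inter> edge_verts G B \<subseteq> {u}"
    and "e \<in> C" "e \<in> A"
  shows "C \<subseteq> A"
proof -
  obtain c where "cycle_walk G c" "C = fst ` set c" "C \<subseteq> walk_edges"
    using cyclesE[OF assms(1)] .
  then show ?thesis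
    using cycle_one_side[of G c A B u] assms(2-6) by auto
qed

text \<open>At a double vertex the cycle stays on one side, and \<open>sides\<close> puts different
  values on different sides. At any other vertex distinct half-edges have different values. A loop
  is the case \<open>d' = d\<close>.\<close>

lemma consecutive_partner:
  assumes c: "cycle_walk G c" "fst ` set c \<subseteq> walk_edges"
    and d: "d \<in> set c" "d' \<in> set c" "step_tail G d' = step_head G d"
  shows "partner (flip d) d'"
proof -
  have edges: "fst d \<in> walk_edges" "fst d' \<in> walk_edges"
    using c(2) d by auto
  have neq: "flip d \<noteq> d'"
    using cycle_walk_inj(1)[OF c(1)] d(1,2) by (metis flip_simps(1,4) inj_onD)
  have srcs: "src d' = src (flip d) \<or> src d' = opp (src (flip d))"
    using half_src_cases[of "flip d" d'] edges d(3) by simp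
  show ?thesis
  proof (cases "double (step_head G d)")
    case True
    then have states: "src (flip d) \<in> states" "opp (src (flip d)) \<in> states"
      using double_states[of "flip d"] edges by auto
    obtain A B where AB: "A \<union> B = walk_edges" "A \<inter> B = {}"
        "edge_verts G A \<inter> edge_verts G B \<subseteq> {fst (src (flip d))}"
        "\<And>x. fst x \<in> walk_edges \<Longrightarrow> src x = src (flip d) \<Longrightarrow> fst x \<in> A"
        "\<And>x. fst x \<in> walk_edges \<Longrightarrow> src x = opp (src (flip d)) \<Longrightarrow> fst x \<in> B"
      using sides[OF states] by metis
    have "fst (flip d) \<in> A"
      using AB(4)[of "flip d"] edges(1) by simp
    then have "fst ` set c \<subseteq> A"
      using cycles_one_side[of "fst ` set c" A B _ "fst d"] AB(1-3) c d(1) by (auto simp: cycles_def is_cycle_iff)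
    then have "fst d' \<in> A"
      using d(2) by auto
    then have "src d' \<noteq> opp (src (flip d))"
      using AB(2) AB(5)[OF edges(2)] by auto
    then show ?thesis
      using srcs neq edges True by (simp add: partner_def)
  next
    case False
    then have "src d' \<noteq> src (flip d)"
      using same_src_double[of "flip d" d'] edges neq by auto
    then show ?thesis
      using srcs neq edges False by (simp add: partner_def)
  qed
qed

lemma cycles_partner:
  assumes "C \<in> cycles" "fst x \<in> C"
  shows "\<exists>y. fst y \<in> C \<and> partner x y"
proof -
  obtain c where c: "cycle_walk G c" "C = fst ` set c" "C \<subseteq> walk_edges"
    using cyclesE[OF assms(1)] .
  then have c_edges: "fst ` set c \<subseteq> walk_edges"
    by simp
  obtain u where u: "route G u c u"
    using cycle_walk_route[OF c(1)] by auto
  obtain d where d: "d \<in> set c" "fst x = fst d"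
    using assms(2) c(2) by auto
  from eq_or_flip[OF d(2)] show ?thesis
  proof
    assume x: "x = d"
    obtain d' where d': "d' \<in> set c" "step_head G d' = step_tail G d"
      using closed_route_pred[OF u d(1)] .
    have "partner (flip d') d"
      using consecutive_partner[OF c(1) c_edges d'(1) d(1)] d'(2) by simp
    then have "partner x (flip d')"
      using partner_sym x by simp
    moreover have "fst (flip d') \<in> C"
      using d'(1) c(2) by simp
    ultimately show ?thesis
      by blast
  next
    assume x: "x = flip d"
    obtain d' where d': "d' \<in> set c" "step_tail G d' = step_head G d"
      using closed_route_succ[OF u d(1)] .
    have "partner x d'"
      using consecutive_partner[OF c(1) c_edges d(1) d'] x by simp
    moreover have "fst d' \<in> C"
      using d'(1) c(2) by simp
    ultimately show ?thesis
      by blast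
  qed
qed

lemma cycles_partner_closed:
  assumes "C \<in> cycles" "fst x \<in> C" "partner x y"
  shows "fst y \<in> C"
  using cycles_partner[OF assms(1,2)] partner_unique[OF assms(3)] by blast

text \<open>Since \<open>D\<close> contains the partners of its half-edges, following
  \<open>C\<close> from a common edge never leaves \<open>D\<close>.\<close>

lemma cycles_subset:
  assumes "C \<in> cycles" "D \<in> cycles" "e \<in> C" "e \<in> D"
  shows "C \<subseteq> D"
proof -
  obtain c where c: "cycle_walk G c" "C = fst ` set c" "C \<subseteq> walk_edges"
    using cyclesE[OF assms(1)] .
  obtain u where u: "route G u c u"
    using cycle_walk_route[OF c(1)] by auto
  obtain d where d: "d \<in> set c" "fst d \<in> D"
    using assms(3,4) c(2) by auto
  have "\<forall>x\<in>set c. fst x \<in> D"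
    using u d
  proof (rule closed_route_induct)
    fix x y assume xy: "x \<in> set c" "y \<in> set c" "step_tail G y = step_head G x" "fst x \<in> D"
    then have "partner (flip x) y"
      using c by (intro consecutive_partner) auto
    then show "fst y \<in> D"
      using cycles_partner_closed[OF assms(2), of "flip x" y] xy(4) by simp
  qed
  then show ?thesis
    using c(2) by auto
qed

lemma cycles_disjoint: "C \<in> cycles \<Longrightarrow> D \<in> cycles \<Longrightarrow> C \<noteq> D \<Longrightarrow> C \<inter> D = {}"
  using cycles_subset by blast

text \<open>The ends of a doubled edge are double vertices at which its half-edge is alone with its
  value, so it has no partner.\<close>

lemma cycles_avoid_doubled_edges:
  assumes "C \<in> cycles"
  shows "C \<inter> doubled_edges = {}"
proof -
  have False if e: "e \<in> C" "e \<in> doubled_edges" for e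
  proof -
    obtain y where y: "partner (e, True) y"
      using cycles_partner[OF assms, of "(e, True)"] e(1) by auto
    have "double (step_tail G (e, True))"
      using doubled_edgesD(4)[of "(e, True)"] e(2) by simp
    then have "src y = src (e, True)" "fst y \<in> walk_edges" "(e, True) \<noteq> y"
      using y by (auto simp: partner_def)
    then show False
      using doubled_edges_unique[of "(e, True)" y] e(2) by auto
  qed
  then show ?thesis
    by auto
qed

text \<open>The edge is traversed only once, by \<open>d\<close>. The rest of the circuit leads from
  the head of \<open>d\<close> back to its tail without this edge, and after loop erasure
  \<open>d\<close> closes it to a cycle.\<close>

lemma edge_in_cycle:
  assumes "e \<in> walk_edges" "e \<notin> doubled_edges"
  shows "\<exists>C\<in>cycles. e \<in> C"
proof -
  obtain d where d: "d \<in> set w" "fst d = e"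
    using assms(1) by auto
  have "flip d \<notin> set w"
  proof
    assume "flip d \<in> set w"
    then have "(e, snd d) \<in> set w" "(e, \<not> snd d) \<in> set w"
      using d by (auto simp: flip_def)
    then show False
      using assms(2) by (cases "snd d") (auto simp: doubled_edges_def)
  qed
  obtain xs ys where w: "w = xs @ d # ys"
    using d(1) by (metis split_list)
  obtain p where "trail p w p"
    using w_trail by blast
  then have "route G (fst p) (xs @ d # ys) (fst p)"
    using trail_route w by metis
  then have "route G (step_head G d) (ys @ xs) (step_tail G d)"
    by (auto simp: route_append)
  then obtain c where c: "route G (step_head G d) c (step_tail G d)" "set c \<subseteq> set (ys @ xs)"
      "distinct (map (step_tail G) c @ [step_tail G d])"
    using route_shortcut[of G "step_head G d" "ys @ xs" "step_tail G d"] by metis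
  have "fst d \<notin> fst ` set c"
  proof
    assume "fst d \<in> fst ` set c"
    then obtain d' where d': "d' \<in> set (ys @ xs)" "fst d' = fst d"
      using c(2) by (metis imageE subsetD)
    have "d' \<noteq> d" "d' \<in> set w"
      using d' distinct_w w by auto
    then show False
      using eq_or_flip[OF d'(2)] \<open>flip d \<notin> set w\<close> by auto
  qed
  moreover have sub: "fst ` set (d # c) \<subseteq> walk_edges"
    using image_mono[OF c(2), of fst] w by auto
  ultimately have "cycle_walk G (d # c)"
    using order_trans[OF sub walk_edges_subset] by (intro cycle_walk_of_simple_route[OF c(1,3)])
  then have "is_cycle G (fst ` set (d # c))"
    unfolding is_cycle_iff by blast
  then have "fst ` set (d # c) \<in> cycles"
    using sub by (simp add: cycles_def)
  then show ?thesis
    using d(2) by (intro bexI) auto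
qed

lemma Union_cycles: "\<Union>cycles = walk_edges - doubled_edges"
proof
  show "\<Union>cycles \<subseteq> walk_edges - doubled_edges"
    using cycles_avoid_doubled_edges by (auto simp: cycles_def)
  show "walk_edges - doubled_edges \<subseteq> \<Union>cycles"
    using edge_in_cycle by blast
qed

lemma doubled_edges_subset: "doubled_edges \<subseteq> walk_edges"
  by (force simp: doubled_edges_def)

text \<open>Let \<open>x\<close> and its partner \<open>y\<close> belong to \<open>C\<close> and
  \<open>z\<close> to \<open>D\<close>, all at \<open>u\<close>. If \<open>u\<close> were not
  double, each value would be taken by one half-edge and there would be no room for
  \<open>z\<close>. At a double vertex \<open>z\<close> is not the partner of \<open>x\<close>, so
  it has the opposite value, and \<open>sides\<close> puts \<open>C\<close> and \<open>D\<close> on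
  different sides.\<close>

lemma shared_vertex:
  assumes C: "C \<in> cycles" "D \<in> cycles" "C \<noteq> D" and u: "u \<in> edge_verts G C" "u \<in> edge_verts G D"
  shows "double u" "edge_verts G C \<inter> edge_verts G D \<subseteq> {u}"
proof -
  obtain x z where x: "fst x \<in> C" "step_tail G x = u" and z: "fst z \<in> D" "step_tail G z = u"
    using u by (metis mem_edge_verts_iff)
  obtain y where y: "fst y \<in> C" "partner x y"
    using cycles_partner[OF C(1) x(1)] by blast
  have edges: "fst x \<in> walk_edges" "fst z \<in> walk_edges" "fst y \<in> walk_edges"
    using C x(1) z(1) y(1) by (auto simp: cycles_def)
  have "C \<inter> D = {}"
    using cycles_disjoint[OF C] .
  then have neq: "z \<noteq> x" "z \<noteq> y"
    using x(1) y(1) z(1) by auto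
  have srcs: "src z = src x \<or> src z = opp (src x)"
    using half_src_cases[OF edges(1,2)] x(2) z(2) by simp
  show double: "double u"
  proof (rule ccontr)
    assume single: "\<not> double u"
    then have "src z \<noteq> src x" "src z \<noteq> src y"
      using same_src_double[OF edges(2,1)] same_src_double[OF edges(2,3)] neq z(2) by auto
    moreover have "src y = opp (src x)"
      using y(2) x(2) single by (simp add: partner_def)
    ultimately show False
      using srcs by auto
  qed
  have "src z \<noteq> src x"
  proof
    assume "src z = src x"
    then have "partner x z"
      using edges neq double x(2) by (auto simp: partner_def)
    then show False
      using partner_unique[OF y(2)] neq by auto
  qed
  then have src_z: "src z = opp (src x)"
    using srcs by auto
  have states: "src x \<in> states" "opp (src x) \<in> states"
    using double_states[OF _ edges(1)] double x(2) by auto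
  obtain A B where AB: "A \<union> B = walk_edges" "A \<inter> B = {}"
      "edge_verts G A \<inter> edge_verts G B \<subseteq> {fst (src x)}"
      "\<And>y. fst y \<in> walk_edges \<Longrightarrow> src y = src x \<Longrightarrow> fst y \<in> A"
      "\<And>y. fst y \<in> walk_edges \<Longrightarrow> src y = opp (src x) \<Longrightarrow> fst y \<in> B"
    using sides[OF states] by metis
  have "C \<subseteq> A"
    using cycles_one_side[OF C(1) AB(1-3) x(1)] AB(4)[OF edges(1)] by auto
  moreover have "D \<subseteq> B"
    using cycles_one_side[OF C(2), of B A, OF _ _ _ z(1)] AB(1-3) AB(5)[OF edges(2) src_z] by (auto simp: Un_commute Int_commute)
  ultimately show "edge_verts G C \<inter> edge_verts G D \<subseteq> {u}"
    using AB(3) edge_verts_mono[of C A G] edge_verts_mono[of D B G] x(2) by auto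
qed

lemma mult_w: "mult w e = (if e \<in> doubled_edges then 2 else if e \<in> walk_edges then 1 else 0)"
proof -
  have "mult w e = length (filter (\<lambda>d. e = fst d) w)"
    unfolding mult_def count_mset count_list_eq_length_filter filter_map length_map comp_def by simp
  also have "\<dots> = card {d \<in> set w. e = fst d}"
    using distinct_w by (metis distinct_card distinct_filter set_filter)
  also have "{d \<in> set w. e = fst d} = {(e, True), (e, False)} \<inter> set w"
    by (auto simp: prod_eq_iff)
  also have "card \<dots> = (if e \<in> doubled_edges then 2 else if e \<in> walk_edges then 1 else 0)"
  proof -
    have "e \<in> walk_edges \<longleftrightarrow> (e, True) \<in> set w \<or> (e, False) \<in> set w"
      by (auto simp: image_iff Bex_def) (metis (full_types))
    then show ?thesis
      by (cases "(e, True) \<in> set w"; cases "(e, False) \<in> set w") (auto simp: doubled_edges_def)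
  qed
  finally show ?thesis .
qed

end

section \<open>The Eulerian cycle-tree of a minimal circuit\<close>

context minimal_bidirected_circuit
begin

text \<open>
  At a vertex of a cycle the two half-edges have equal values if the vertex is double and opposite
  values otherwise, while the values on the halves of \<open>e\<close> multiply to \<open>- esign G e\<close>.
\<close>

lemma cycle_sign:
  assumes "C \<in> cycles"
  shows "(\<Prod>e\<in>C. esign G e) = (- 1) ^ card (edge_verts G C \<inter> Collect double)"
proof -
  obtain c where c: "cycle_walk G c" "C = fst ` set c" "C \<subseteq> walk_edges"
    using cyclesE[OF assms] .
  then have c_edges: "fst ` set c \<subseteq> walk_edges"
    by simp
  obtain u where u: "route G u c u"
    using cycle_walk_route[OF c(1)] by auto
  note inj = cycle_walk_inj[OF c(1)]
  have heads: "step_head G ` set c = step_tail G ` set c"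
    using closed_route_heads[OF u] by (metis set_map set_mset_mset)
  \<comment> \<open>The step of the cycle that follows \<open>d\<close>; a permutation of the
    steps.\<close>
  define s where "s d = inv_into (set c) (step_tail G) (step_head G d)" for d
  have s: "s d \<in> set c" "step_tail G (s d) = step_head G d" if "d \<in> set c" for d
  proof -
    have "step_head G d \<in> step_tail G ` set c"
      using that heads by blast
    then show "s d \<in> set c" "step_tail G (s d) = step_head G d"
      unfolding s_def by (rule inv_into_into, rule f_inv_into_f)
  qed
  have "inj_on s (set c)"
    using s(2) inj(3) by (metis inj_on_def)
  moreover from this have "s ` set c = set c"
    using s(1) by (intro endo_inj_surj) auto
  ultimately have reindex: "(\<Prod>d\<in>set c. snd (src d)) = (\<Prod>d\<in>set c. snd (src (s d)))"
    using prod.reindex[of s "set c" "\<lambda>d. snd (src d)"] by (simp add: comp_def)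
  have edge: "fst d \<in> edges G" if "d \<in> set c" for d
    using that c_edges walk_edges_subset by blast
  have "(\<Prod>e\<in>C. esign G e) = (\<Prod>d\<in>set c. esign G (fst d))"
    unfolding c(2) using inj(1) by (simp add: prod.reindex)
  also have "\<dots> = (\<Prod>d\<in>set c. - snd (src (flip d)) * snd (src d))"
  proof (rule prod.cong)
    fix d assume "d \<in> set c"
    then show "esign G (fst d) = - snd (src (flip d)) * snd (src d)"
      using omega_prod'[OF edge, of d "snd d"] by (simp add: src_def tgt_def mult.commute)
  qed simp
  \<comment> \<open>Shifting the departures along \<open>s\<close> regroups the product by vertices:
    each factor now pairs the two half-edges that meet at the head of \<open>d\<close>.\<close>
  also have "\<dots> = (\<Prod>d\<in>set c. - snd (src (flip d)) * snd (src (s d)))"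
    by (simp add: prod.distrib reindex)
  also have "\<dots> = (\<Prod>d\<in>set c. if double (step_head G d) then - 1 else 1)"
  proof (rule prod.cong)
    fix d assume d: "d \<in> set c"
    have "partner (flip d) (s d)"
      using consecutive_partner[OF c(1) c_edges d s[OF d]] .
    moreover have "snd (src (flip d)) = 1 \<or> snd (src (flip d)) = - 1"
      using half_value[of "flip d"] d c_edges by auto
    ultimately show "- snd (src (flip d)) * snd (src (s d)) = (if double (step_head G d) then - 1 else 1)"
      by (auto simp: partner_def)
  qed simp
  also have "\<dots> = (\<Prod>u\<in>step_head G ` set c. if double u then - 1 else 1)"
    using inj(3) by (simp add: prod.reindex)
  also have "step_head G ` set c = edge_verts G C"
    using closed_route_verts[OF u] c(2) heads by simp
  also have "(\<Prod>u\<in>edge_verts G C. if double u then - 1 else 1) = (- 1 :: int) ^ card (edge_verts G C \<inter> Collect double)"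
  proof -
    have "finite (edge_verts G C)"
      using closed_route_verts[OF u] c(2) by simp
    then show ?thesis
      by (simp add: prod.If_cases)
  qed
  finally show ?thesis .
qed

section \<open>The subgraph of the walk and its cut-points\<close>

definition subgraph :: "('v, 'e) sgraph" where
  "subgraph = walk_subgraph G w"

lemma subgraph_simps [simp]:
  "edges subgraph = walk_edges" "verts subgraph = edge_verts G walk_edges" "ends subgraph = ends G"
  "esign subgraph = esign G" "edge_verts subgraph = edge_verts G" "step_tail subgraph = step_tail G"
  "step_head subgraph = step_head G" "path_verts subgraph = path_verts G"
  by (auto simp: subgraph_def walk_subgraph_def edge_verts_def[abs_def] step_tail_def[abs_def]
      step_head_def[abs_def] path_verts_def[abs_def])

lemma subgraph_is_cycle: "{C. is_cycle subgraph C} = cycles"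
proof -
  have "closed_walk subgraph c \<longleftrightarrow> closed_walk G c \<and> fst ` set c \<subseteq> walk_edges" for c
    using order_trans[OF _ walk_edges_subset, of "fst ` set c"] by (auto simp: closed_walk_def walk_def)
  then show ?thesis
    by (auto simp: cycles_def is_cycle_def)
qed

lemma subgraph_signed_graph: "signed_graph subgraph"
proof -
  have "finite (edge_verts G walk_edges)"
  proof -
    have "edge_verts G walk_edges = (\<lambda>(d, h). ends G (fst d) h) ` (set w \<times> UNIV)"
      by (force simp: edge_verts_def)
    then show ?thesis
      by simp
  qed
  then show ?thesis
    using walk_edges_subset esign_values by (auto simp: signed_graph_def edge_verts_def)
qed

lemma subgraph_signed_subgraph: "signed_subgraph subgraph G"
proof -
  have "edge_verts G walk_edges \<subseteq> verts G"
    using walk_edges_subset graph by (auto simp: edge_verts_def signed_graph_def)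
  then show ?thesis
    using subgraph_signed_graph walk_edges_subset by (simp add: signed_subgraph_def)
qed

lemma subgraph_connected: "connected_sgraph subgraph"
  using connected_walk_subgraph w_nonempty w_trail trail_route unfolding subgraph_def by metis

lemma double_cut_point:
  assumes "double u"
  shows "cut_point subgraph u"
proof -
  have states: "(u, 1) \<in> states" "opp (u, 1) \<in> states"
    using assms by (auto simp: double_def opp_def)
  obtain A B where AB: "A \<union> B = walk_edges" "A \<inter> B = {}" "A \<noteq> {}" "B \<noteq> {}"
      "edge_verts G A \<inter> edge_verts G B \<subseteq> {u}"
    using sides[OF states] by (metis fst_conv)
  obtain d where "d \<in> set w" "src d = (u, 1)"
    using states(1) by (auto simp: states_def)
  then have "u \<in> edge_verts G walk_edges"
    using step_tail_in_edge_verts[of d walk_edges G] by (auto simp: src_def)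
  then show ?thesis
    using AB subgraph_signed_graph subgraph_connected
    by (intro cut_point_of_separation[of _ _ A B]) auto
qed

section \<open>Paths formed by the doubled edges\<close>

lemma doubled_edges_at_vertex:
  assumes "fst y \<in> doubled_edges" "fst y' \<in> doubled_edges" "y \<noteq> y'"
    and "step_tail G y = u" "step_tail G y' = u" "fst x \<in> walk_edges" "step_tail G x = u"
  shows "fst x \<in> doubled_edges"
proof -
  have edges: "fst y \<in> walk_edges" "fst y' \<in> walk_edges"
    using assms(1,2) doubled_edges_subset by auto
  \<comment> \<open>Each of the two is alone with its value, so together they occupy both values at
    \<open>u\<close>.\<close>
  have "src y \<noteq> src y'"
    using doubled_edges_unique[OF assms(1) edges(2)] assms(3) by auto
  then have "src x = src y \<or> src x = src y'"
    using half_src_cases[OF edges(1) assms(6)] half_src_cases[OF edges] assms(4,5,7) by auto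
  then show ?thesis
    using doubled_edges_unique[OF assms(1,6)] doubled_edges_unique[OF assms(2,6)] assms(1,2) by auto
qed

text \<open>Half-edges of doubled edges at a vertex have pairwise different values, which bounds
  degrees by two; cycles avoid doubled edges, which gives acyclicity.\<close>

lemma doubled_path_decomposition: "\<exists>P. path_decomposition G doubled_edges P"
proof (rule exists_path_decomposition)
  show "finite doubled_edges"
    using finite_subset[OF doubled_edges_subset] by simp
  show "doubled_edges \<subseteq> edges G"
    using doubled_edges_subset walk_edges_subset by (rule order_trans)
  show "x = y \<or> y = z \<or> x = z"
    if "fst x \<in> doubled_edges" "fst y \<in> doubled_edges" "fst z \<in> doubled_edges"
      "step_tail G y = step_tail G x" "step_tail G z = step_tail G x" for x y z
  proof -
    have edges: "fst x \<in> walk_edges" "fst y \<in> walk_edges" "fst z \<in> walk_edges"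
      using that doubled_edges_subset by auto
    then have "src x = src y \<or> src y = src z \<or> src x = src z"
      using half_src_cases[of x y] half_src_cases[of x z] that(4,5) by auto
    then show ?thesis
      using doubled_edges_unique that(1-3) edges by metis
  qed
  show "\<not> C \<subseteq> doubled_edges" if "is_cycle G C" for C
  proof
    assume C: "C \<subseteq> doubled_edges"
    then have "C \<in> cycles"
      using that doubled_edges_subset by (auto simp: cycles_def)
    then have "C = {}"
      using C cycles_avoid_doubled_edges by blast
    then show False
      using that by (auto simp: is_cycle_def closed_walk_def walk_def)
  qed
qed

text \<open>
  Block paths of length zero are not needed: a vertex shared by two block cycles is an intersection
  vertex in any case.
\<close>

definition block_paths :: "('v \<times> ('e \<times> bool) list) set" where
  "block_paths = (SOME P. path_decomposition G doubled_edges P)"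

lemma block_paths: "path_decomposition G doubled_edges block_paths"
  unfolding block_paths_def using doubled_path_decomposition by (rule someI_ex)

lemma Union_block_paths: "(\<Union>p\<in>block_paths. path_edges p) = doubled_edges"
  using block_paths by (simp add: path_decomposition_def)

lemma block_path:
  assumes "p \<in> block_paths"
  shows "snd p \<noteq> []" "route G (fst p) (snd p) (last (path_verts G p))" "distinct (path_verts G p)"
    "path_verts G p = map (step_tail G) (snd p) @ [last (path_verts G p)]"
    "path_edges p \<subseteq> doubled_edges"
    "set (path_verts G p) = edge_verts G (path_edges p)"
    "fst p \<noteq> last (path_verts G p)"
proof -
  note props = block_paths[unfolded path_decomposition_def, THEN conjunct1, THEN bspec, OF assms]
  show ne: "snd p \<noteq> []" and dist: "distinct (path_verts G p)"
    using props by auto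
  obtain v where v: "route G (fst p) (snd p) v"
    using props by blast
  have verts: "path_verts G p = map (step_tail G) (snd p) @ [v]"
    using route_verts[OF v] by (simp add: path_verts_def)
  then have last: "last (path_verts G p) = v"
    by simp
  show "route G (fst p) (snd p) (last (path_verts G p))"
    "path_verts G p = map (step_tail G) (snd p) @ [last (path_verts G p)]"
    using v verts last by auto
  show "path_edges p \<subseteq> doubled_edges"
    using Union_block_paths assms by auto
  show "set (path_verts G p) = edge_verts G (path_edges p)"
    using set_path_verts_subset[OF v ne] edge_verts_route[OF v] by (auto simp: path_verts_def path_edges_def)
  show "fst p \<noteq> last (path_verts G p)"
    using dist ne last_in_set[of "map (step_head G) (snd p)"] by (auto simp: path_verts_def)
qed

lemma block_path_start:
  assumes "p \<in> block_paths"
  shows "fst (hd (snd p)) \<in> path_edges p" "step_tail G (hd (snd p)) = fst p"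
    and "fst y \<in> doubled_edges \<Longrightarrow> step_tail G y = fst p \<Longrightarrow> y = hd (snd p)"
proof -
  note p = block_path[OF assms]
  show "fst (hd (snd p)) \<in> path_edges p" "step_tail G (hd (snd p)) = fst p"
    using p(1,2) by (auto simp: path_edges_def route_iff)
  show "y = hd (snd p)" if "fst y \<in> doubled_edges" "step_tail G y = fst p"
    using block_paths that assms unfolding path_decomposition_def by blast
qed

lemma block_path_end:
  assumes "p \<in> block_paths"
  shows "fst (flip (last (snd p))) \<in> path_edges p" "step_tail G (flip (last (snd p))) = last (path_verts G p)"
    and "fst y \<in> doubled_edges \<Longrightarrow> step_tail G y = last (path_verts G p) \<Longrightarrow> y = flip (last (snd p))"
proof -
  note p = block_path[OF assms]
  show "fst (flip (last (snd p))) \<in> path_edges p" "step_tail G (flip (last (snd p))) = last (path_verts G p)"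
    using p(1,2) by (auto simp: path_edges_def route_iff)
  show "y = flip (last (snd p))" if "fst y \<in> doubled_edges" "step_tail G y = last (path_verts G p)"
    using block_paths that assms unfolding path_decomposition_def by blast
qed

text \<open>The two path half-edges at an inner vertex occupy both values there. In particular no
  cycle passes through it.\<close>

lemma block_path_interior:
  assumes "p \<in> block_paths" "u \<in> set (path_verts G p)" "u \<noteq> fst p" "u \<noteq> last (path_verts G p)"
    and "fst x \<in> walk_edges" "step_tail G x = u"
  shows "fst x \<in> doubled_edges"
proof -
  note p = block_path[OF assms(1)]
  obtain y y' where "y \<noteq> y'" "fst y \<in> path_edges p" "fst y' \<in> path_edges p" "step_tail G y = u" "step_tail G y' = u"
    using simple_route_interior[OF p(2), of u] p(3,4) assms(2-4) unfolding path_edges_def by metis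
  then show ?thesis
    using doubled_edges_at_vertex[of y y' u x] p(5) assms(5,6) by auto
qed

text \<open>Both ends of a path are treated at once, with \<open>x\<close> the half-edge of the path
  at the end \<open>v\<close>. The step \<open>z\<close> that leaves \<open>v\<close> in the state
  opposite to \<open>src x\<close> is not on a doubled edge, so it lies on a cycle \<open>C\<close>.
  Path and cycle are on different sides of \<open>v\<close>. Any cycle through \<open>v\<close> has
  a half-edge of the value of \<open>z\<close> there, which is \<open>z\<close> or its partner, so
  it shares an edge with \<open>C\<close>.\<close>

lemma block_path_end_cycle:
  assumes p: "p \<in> block_paths" and x: "fst x \<in> path_edges p" "step_tail G x = v"
    and v: "v \<in> {fst p, last (path_verts G p)}"
    and unique: "\<And>y. fst y \<in> doubled_edges \<Longrightarrow> step_tail G y = v \<Longrightarrow> y = x"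
  shows "\<exists>C\<in>cycles. set (path_verts G p) \<inter> edge_verts G C = {v} \<and>
    (\<forall>B\<in>cycles. v \<in> edge_verts G B \<longrightarrow> B = C)"
proof -
  note p_props = block_path[OF p]
  have x_doubled: "fst x \<in> doubled_edges"
    using x(1) p_props(5) by auto
  note xD = doubled_edgesD[OF x_doubled]
  have states: "src x \<in> states" "opp (src x) \<in> states"
    using src_in_states[OF xD(1)] opp_src_in_states[OF xD(2)] .
  obtain z where z: "z \<in> set w" "src z = opp (src x)"
    using states(2) by (auto simp: states_def)
  have z_tail: "step_tail G z = v"
    using z(2) x(2) by (metis fst_src opp_simps(1))
  have z_edge: "fst z \<in> walk_edges"
    using z(1) by simp
  have "z \<noteq> x"
  proof
    assume "z = x"
    then have "snd (src x) = - snd (src x)"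
      using z(2) by (metis opp_simps(2))
    then show False
      using half_value[OF xD(3)] by auto
  qed
  then have "fst z \<notin> doubled_edges"
    using unique[OF _ z_tail] by auto
  then obtain C where C: "C \<in> cycles" "fst z \<in> C"
    using edge_in_cycle[OF z_edge] by auto
  obtain A B where AB: "A \<union> B = walk_edges" "A \<inter> B = {}"
      "edge_verts G A \<inter> edge_verts G B \<subseteq> {fst (src x)}"
      "\<And>y. fst y \<in> walk_edges \<Longrightarrow> src y = src x \<Longrightarrow> fst y \<in> A"
      "\<And>y. fst y \<in> walk_edges \<Longrightarrow> src y = opp (src x) \<Longrightarrow> fst y \<in> B"
    using sides[OF states] by metis
  have A_v: "edge_verts G A \<inter> edge_verts G B \<subseteq> {v}" and B_v: "edge_verts G B \<inter> edge_verts G A \<subseteq> {v}"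
    using AB(3) x(2) by auto
  have "C \<subseteq> B"
    using cycles_one_side[OF C(1) _ _ B_v C(2) AB(5)[OF z_edge z(2)]] AB(1,2) by (simp add: Un_commute Int_commute)
  have path_A: "path_edges p \<subseteq> A"
  proof -
    obtain d c where dc: "snd p = d # c"
      using p_props(1) by (cases "snd p") auto
    have r: "route G (fst p) (d # c) (last (path_verts G p))"
      using p_props(2) dc by simp
    have "distinct (map (step_tail G) (snd p) @ [last (path_verts G p)])"
      using p_props(3,4) by simp
    then have "fst p \<notin> step_tail G ` set c" "last (path_verts G p) \<notin> step_tail G ` set c"
      using block_path_start(2)[OF p] dc by auto
    then have v_c: "v \<notin> step_tail G ` set c"
      using v by (metis insertE singletonD)
    have "fst ` set (d # c) \<subseteq> A \<union> B"
      unfolding AB(1) using order_trans[OF p_props(5) doubled_edges_subset] dc by (simp add: path_edges_def)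
    then have sub: "fst ` set (d # c) \<subseteq> A \<union> B" "fst ` set (d # c) \<subseteq> B \<union> A"
      by (simp_all add: Un_commute)
    \<comment> \<open>A path starting on side \<open>B\<close> would stay there, but it contains the
      edge of \<open>x\<close>, which is on side \<open>A\<close>.\<close>
    have "fst d \<in> A"
    proof (rule ccontr)
      assume "fst d \<notin> A"
      then have "fst ` set (d # c) \<subseteq> B"
        using sub by (intro route_one_side[OF r sub(2) B_v v_c]) auto
      then have "fst x \<in> B"
        using x(1) dc by (auto simp: path_edges_def)
      then show False
        using AB(2) AB(4)[OF xD(3)] by auto
    qed
    then show ?thesis
      using route_one_side[OF r sub(1) A_v v_c] dc by (simp add: path_edges_def)
  qed
  have "set (path_verts G p) \<inter> edge_verts G C \<subseteq> {v}"
    using p_props(6) edge_verts_mono[OF path_A, of G] edge_verts_mono[OF \<open>C \<subseteq> B\<close>, of G] A_v by auto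
  moreover have "v \<in> set (path_verts G p)"
    using p_props(6) step_tail_in_edge_verts[OF x(1), of G] x(2) by simp
  moreover have "v \<in> edge_verts G C"
    using step_tail_in_edge_verts[OF C(2), of G] z_tail by simp
  ultimately have meet: "set (path_verts G p) \<inter> edge_verts G C = {v}"
    by auto
  have "B' = C" if B': "B' \<in> cycles" "v \<in> edge_verts G B'" for B'
  proof -
    obtain y where y: "fst y \<in> B'" "step_tail G y = v"
      using B'(2) by (metis mem_edge_verts_iff)
    have y_edge: "fst y \<in> walk_edges"
      using y(1) B'(1) by (auto simp: cycles_def)
    have "fst y \<notin> doubled_edges"
      using cycles_avoid_doubled_edges[OF B'(1)] y(1) by auto
    then have "src y \<noteq> src x"
      using doubled_edges_unique[OF x_doubled y_edge] x_doubled by auto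
    then have src_y: "src z = src y"
      using half_src_cases[OF xD(3) y_edge] z(2) y(2) x(2) by simp
    have "fst z \<in> B'"
    proof (cases "y = z")
      case False
      then have "partner y z"
        using y_edge z_edge src_y xD(4) x(2) y(2) by (simp add: partner_def)
      then show ?thesis
        using cycles_partner_closed[OF B'(1) y(1)] by simp
    qed (use y in simp)
    then show ?thesis
      using cycles_disjoint[OF B'(1) C(1)] C(2) by auto
  qed
  with meet show ?thesis
    by (intro bexI[OF _ C(1)] conjI ballI impI)
qed

lemma block_path_cycles:
  assumes "p \<in> block_paths"
  shows "\<exists>C\<in>cycles. \<exists>D\<in>cycles. C \<noteq> D \<and>
    set (path_verts G p) \<inter> edge_verts G C = {hd (path_verts G p)} \<and>
    set (path_verts G p) \<inter> edge_verts G D = {last (path_verts G p)} \<and>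
    (\<forall>B\<in>cycles - {C, D}. set (path_verts G p) \<inter> edge_verts G B = {})"
proof -
  obtain C where C: "C \<in> cycles" "set (path_verts G p) \<inter> edge_verts G C = {fst p}"
      "\<And>B. B \<in> cycles \<Longrightarrow> fst p \<in> edge_verts G B \<Longrightarrow> B = C"
    using block_path_end_cycle[OF assms block_path_start(1,2)[OF assms] _ block_path_start(3)[OF assms]] by blast
  obtain D where D: "D \<in> cycles" "set (path_verts G p) \<inter> edge_verts G D = {last (path_verts G p)}"
      "\<And>B. B \<in> cycles \<Longrightarrow> last (path_verts G p) \<in> edge_verts G B \<Longrightarrow> B = D"
    using block_path_end_cycle[OF assms block_path_end(1,2)[OF assms] _ block_path_end(3)[OF assms]] by blast
  have "C \<noteq> D"
    using C(2) D(2) block_path(7)[OF assms] by auto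
  moreover have "set (path_verts G p) \<inter> edge_verts G B = {}" if B: "B \<in> cycles - {C, D}" for B
  proof (rule ccontr)
    assume "set (path_verts G p) \<inter> edge_verts G B \<noteq> {}"
    then obtain u where u: "u \<in> set (path_verts G p)" "u \<in> edge_verts G B"
      by auto
    have ends: "u \<noteq> fst p" "u \<noteq> last (path_verts G p)"
      using C(3)[of B] D(3)[of B] B u(2) by auto
    obtain x where x: "fst x \<in> B" "step_tail G x = u"
      using u(2) by (metis mem_edge_verts_iff)
    have "fst x \<in> walk_edges"
      using x(1) B by (auto simp: cycles_def)
    then have "fst x \<in> doubled_edges"
      using block_path_interior[OF assms u(1) ends] x(2) by simp
    then show False
      using cycles_avoid_doubled_edges[of B] B x(1) by auto
  qed
  ultimately show ?thesis
    using C(1,2) D(1,2) by (intro bexI[of _ C] bexI[of _ D]) (auto simp: path_verts_def)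
qed

section \<open>Intersection vertices are the double vertices on cycles\<close>

lemma intersection_verts_double:
  assumes "u \<in> intersection_verts subgraph cycles block_paths"
  shows "double u"
proof -
  have "hd (path_verts G p) = fst p" for p
    by (simp add: path_verts_def)
  then have "(\<exists>C\<in>cycles. \<exists>D\<in>cycles. C \<noteq> D \<and> u \<in> edge_verts G C \<and> u \<in> edge_verts G D) \<or>
      (\<exists>p\<in>block_paths. u = fst p \<or> u = last (path_verts G p))"
    using assms by (simp add: intersection_verts_def)
  then consider C D where "C \<in> cycles" "D \<in> cycles" "C \<noteq> D" "u \<in> edge_verts G C" "u \<in> edge_verts G D"
    | p where "p \<in> block_paths" "u = fst p \<or> u = last (path_verts G p)"
    by blast
  then show ?thesis
  proof cases
    case 1
    then show ?thesis
      using shared_vertex(1) by blast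
  next
    case 2
    then obtain x where "fst x \<in> path_edges p" "step_tail G x = u"
      using block_path_start(1,2) block_path_end(1,2) by metis
    then show ?thesis
      using doubled_edgesD(4) block_path(5)[OF 2(1)] by blast
  qed
qed

text \<open>Consider the step \<open>z\<close> that leaves \<open>u\<close> in the state opposite to
  \<open>src x\<close>. If its edge is doubled, it lies on a block path, and \<open>u\<close> is an
  end of this path because the edge of \<open>x\<close> is not doubled. Otherwise it lies on a cycle
  on the other side of \<open>u\<close>.\<close>

lemma double_intersection_verts:
  assumes "C \<in> cycles" "u \<in> edge_verts G C" "double u"
  shows "u \<in> intersection_verts subgraph cycles block_paths"
proof -
  obtain x where x: "fst x \<in> C" "step_tail G x = u"
    using assms(2) by (metis mem_edge_verts_iff)
  have x_edge: "fst x \<in> walk_edges"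
    using x(1) assms(1) by (auto simp: cycles_def)
  have states: "src x \<in> states" "opp (src x) \<in> states"
    using double_states[OF _ x_edge] assms(3) x(2) by auto
  obtain z where z: "z \<in> set w" "src z = opp (src x)"
    using states(2) by (auto simp: states_def)
  have z_tail: "step_tail G z = u"
    using z(2) x(2) by (metis fst_src opp_simps(1))
  have z_edge: "fst z \<in> walk_edges"
    using z(1) by simp
  show ?thesis
  proof (cases "fst z \<in> doubled_edges")
    case True
    then obtain p where p: "p \<in> block_paths" "fst z \<in> path_edges p"
      using Union_block_paths by blast
    have u: "u \<in> set (path_verts G p)"
      using step_tail_in_edge_verts[OF p(2), of G] block_path(6)[OF p(1)] z_tail by simp
    have "fst x \<notin> doubled_edges"
      using cycles_avoid_doubled_edges[OF assms(1)] x(1) by auto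
    then have "u = fst p \<or> u = last (path_verts G p)"
      using block_path_interior[OF p(1) u _ _ x_edge x(2)] by blast
    moreover have "fst p = hd (path_verts G p)"
      by (simp add: path_verts_def)
    ultimately show ?thesis
      using p(1) by (auto simp: intersection_verts_def)
  next
    case False
    then obtain D where D: "D \<in> cycles" "fst z \<in> D"
      using edge_in_cycle[OF z_edge] by auto
    obtain A B where AB: "A \<union> B = walk_edges" "A \<inter> B = {}"
        "edge_verts G A \<inter> edge_verts G B \<subseteq> {fst (src x)}"
        "\<And>y. fst y \<in> walk_edges \<Longrightarrow> src y = src x \<Longrightarrow> fst y \<in> A"
        "\<And>y. fst y \<in> walk_edges \<Longrightarrow> src y = opp (src x) \<Longrightarrow> fst y \<in> B"
      using sides[OF states] by metis
    have "C \<subseteq> A"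
      using cycles_one_side[OF assms(1) AB(1-3) x(1)] AB(4)[OF x_edge] by auto
    then have "D \<noteq> C"
      using D(2) AB(2) AB(5)[OF z_edge z(2)] by auto
    moreover have "u \<in> edge_verts G D"
      using step_tail_in_edge_verts[OF D(2), of G] z_tail by simp
    ultimately show ?thesis
      using assms(1,2) D(1) by (auto simp: intersection_verts_def)
  qed
qed

lemma cycle_tree_subgraph: "cycle_tree G subgraph cycles block_paths"
  unfolding cycle_tree_def
proof (intro conjI)
  show "signed_subgraph subgraph G" "connected_sgraph subgraph"
    by (fact subgraph_signed_subgraph subgraph_connected)+
  show "edges subgraph = \<Union>cycles \<union> (\<Union>p\<in>block_paths. path_edges p)"
    using Union_cycles Union_block_paths doubled_edges_subset by auto
  have "walk_edges = \<Union>cycles \<union> doubled_edges"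
    using Union_cycles doubled_edges_subset by auto
  moreover have "edge_verts G (A \<union> B) = edge_verts G A \<union> edge_verts G B" for A B
    by (auto simp: edge_verts_def)
  ultimately have "edge_verts G walk_edges = edge_verts G (\<Union>cycles) \<union> edge_verts G doubled_edges"
    by simp
  moreover have "edge_verts G doubled_edges = (\<Union>p\<in>block_paths. set (path_verts G p))"
    using block_path(6) unfolding Union_block_paths[symmetric] by (auto simp: edge_verts_def)
  ultimately show "verts subgraph = edge_verts subgraph (\<Union>cycles) \<union> (\<Union>p\<in>block_paths. set (path_verts subgraph p))"
    by simp
  show "cycles = {C. is_cycle subgraph C}"
    by (simp add: subgraph_is_cycle)
  show "\<forall>p\<in>block_paths. simple_path subgraph p"
  proof
    fix p assume p: "p \<in> block_paths"
    note props = block_path[OF p]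
    have "fst p \<in> edge_verts G walk_edges"
      using props(5,6) edge_verts_mono[of "path_edges p" walk_edges G] doubled_edges_subset
      by (auto simp: path_verts_def)
    moreover have "step_tail G (snd p ! i) = path_verts G p ! i" if "i < length (snd p)" for i
      using that by (subst props(4)) (simp add: nth_append)
    ultimately show "simple_path subgraph p"
      using props(3,5) doubled_edges_subset by (auto simp: simple_path_def)
  qed
  show "\<forall>C\<in>cycles. \<forall>D\<in>cycles. C \<noteq> D \<longrightarrow> C \<inter> D = {}"
    using cycles_disjoint by blast
  show "\<forall>C\<in>cycles. \<forall>p\<in>block_paths. C \<inter> path_edges p = {}"
    using cycles_avoid_doubled_edges block_path(5) by blast
  show "\<forall>p\<in>block_paths. \<forall>q\<in>block_paths. p \<noteq> q \<longrightarrow>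
      set (path_verts subgraph p) \<inter> set (path_verts subgraph q) = {}"
    using block_paths by (simp add: path_decomposition_def)
  show "\<forall>C\<in>cycles. \<forall>D\<in>cycles. C \<noteq> D \<longrightarrow> card (edge_verts subgraph C \<inter> edge_verts subgraph D) \<le> 1"
  proof (intro ballI impI)
    fix C D assume CD: "C \<in> cycles" "D \<in> cycles" "C \<noteq> D"
    show "card (edge_verts subgraph C \<inter> edge_verts subgraph D) \<le> 1"
    proof (cases "edge_verts G C \<inter> edge_verts G D = {}")
      case False
      then obtain u where "u \<in> edge_verts G C" "u \<in> edge_verts G D"
        by auto
      then have "edge_verts G C \<inter> edge_verts G D \<subseteq> {u}"
        using shared_vertex(2)[OF CD] by simp
      then show ?thesis
        using card_mono[of "{u}"] by simp
    qed simp
  qed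
  show "\<forall>p\<in>block_paths. \<exists>C\<in>cycles. \<exists>D\<in>cycles. C \<noteq> D \<and>
      set (path_verts subgraph p) \<inter> edge_verts subgraph C = {hd (path_verts subgraph p)} \<and>
      set (path_verts subgraph p) \<inter> edge_verts subgraph D = {last (path_verts subgraph p)} \<and>
      (\<forall>B\<in>cycles - {C, D}. set (path_verts subgraph p) \<inter> edge_verts subgraph B = {})"
    using block_path_cycles by simp
  show "\<forall>v\<in>intersection_verts subgraph cycles block_paths. cut_point subgraph v"
    using intersection_verts_double double_cut_point by blast
qed

lemma eulerian_cycle_tree_subgraph: "eulerian_cycle_tree G subgraph cycles block_paths"
proof -
  have "edge_verts G C \<inter> intersection_verts subgraph cycles block_paths = edge_verts G C \<inter> Collect double"
    if "C \<in> cycles" for C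
    using double_intersection_verts[OF that] intersection_verts_double by auto
  moreover have "balanced subgraph C \<longleftrightarrow> even (card (edge_verts G C \<inter> Collect double))" if "C \<in> cycles" for C
    using cycle_sign[OF that] by (simp add: balanced_def minus_one_power_iff)
  ultimately show ?thesis
    using cycle_tree_subgraph by (simp add: eulerian_cycle_tree_def)
qed

lemma tree_indicator_mult: "tree_indicator cycles block_paths e = int (mult w e)"
  using doubled_edges_subset by (auto simp: tree_indicator_def mult_w Union_cycles Union_block_paths)

end

lemma (in bidirected_graph) minimal_circuit_cycle_tree:
  assumes "minimal_circuit w"
  shows "\<exists>\<C> \<P>. eulerian_cycle_tree G (walk_subgraph G w) \<C> \<P> \<and>
    (\<forall>e. tree_indicator \<C> \<P> e = int (mult w e))"
proof -
  interpret minimal_bidirected_circuit G \<omega> w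
    using assms by unfold_locales
  show ?thesis
    using eulerian_cycle_tree_subgraph tree_indicator_mult unfolding subgraph_def by blast
qed

section \<open>Flows and their orientations\<close>

locale flow_bidirected_graph =
  fixes G :: "('v, 'e) sgraph" and \<epsilon> :: "'e \<Rightarrow> bool \<Rightarrow> int" and f :: "'e \<Rightarrow> int"
  assumes signed: "signed_graph G" and oriented: "orientation G \<epsilon>"
begin

abbreviation orient_flow :: "'e \<Rightarrow> bool \<Rightarrow> int" where
  "orient_flow \<equiv> flow_orientation \<epsilon> f"

sublocale bidirected_graph G orient_flow
proof
  show "orientation G orient_flow"
    using oriented by (auto simp: orientation_def flow_orientation_def)
qed (fact signed)

abbreviation cpl :: "'e \<Rightarrow> int" where
  "cpl \<equiv> coupling \<epsilon> orient_flow"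

lemma epsilon_square:
  assumes "e \<in> edges G"
  shows "\<epsilon> e h * \<epsilon> e h = 1"
proof -
  have "\<epsilon> e h = 1 \<or> \<epsilon> e h = - 1"
    using oriented assms by (auto simp: orientation_def)
  then show ?thesis
    by auto
qed

lemma cpl_eq: "e \<in> edges G \<Longrightarrow> cpl e = (if f e < 0 then - 1 else 1)"
  using epsilon_square[of e True] by (simp add: coupling_def flow_orientation_def)

lemma flow_eq_cpl_abs: "e \<in> edges G \<Longrightarrow> f e = cpl e * \<bar>f e\<bar>"
  by (simp add: cpl_eq)

lemma inc_coeff_cpl: "e \<in> edges G \<Longrightarrow> inc_coeff G \<epsilon> v e * cpl e = inc_coeff G orient_flow v e"
  by (simp add: cpl_eq inc_coeff_def flow_orientation_def)

text \<open>Reversing an edge negates its incidence coefficients, and \<open>cpl\<close> is -1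
  exactly on the reversed edges; so multiplication by it translates between flows for the two
  orientations.\<close>

lemma integral_flow_cpl:
  "integral_flow G \<epsilon> (\<lambda>e. cpl e * g e) \<longleftrightarrow> integral_flow G orient_flow g"
proof -
  have "(\<Sum>e\<in>edges G. inc_coeff G \<epsilon> v e * (cpl e * g e)) = (\<Sum>e\<in>edges G. inc_coeff G orient_flow v e * g e)" for v
    by (rule sum.cong) (simp_all add: inc_coeff_cpl[symmetric])
  then show ?thesis
    by (simp add: integral_flow_def)
qed

lemma integral_flow_abs:
  assumes "integral_flow G \<epsilon> f"
  shows "integral_flow G orient_flow (\<lambda>e. \<bar>f e\<bar>)"
proof -
  have "(\<Sum>e\<in>edges G. inc_coeff G \<epsilon> v e * f e) = (\<Sum>e\<in>edges G. inc_coeff G \<epsilon> v e * (cpl e * \<bar>f e\<bar>))" for v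
    by (rule sum.cong) (simp_all add: flow_eq_cpl_abs[symmetric])
  then show ?thesis
    using assms unfolding integral_flow_cpl[symmetric] by (simp add: integral_flow_def)
qed

lemma char_vec_mult:
  assumes "x \<in> edges G"
  shows "char_vec \<epsilon> w (dir_of orient_flow w) x = cpl x * int (mult w x)"
proof -
  have "char_vec \<epsilon> w (dir_of orient_flow w) x = (\<Sum>i | i < length w \<and> fst (w ! i) = x. cpl x)"
    unfolding char_vec_def
  proof (rule sum.cong)
    fix i assume "i \<in> {i. i < length w \<and> fst (w ! i) = x}"
    then show "\<epsilon> x (snd (w ! i)) * dir_of orient_flow w i (snd (w ! i)) = cpl x"
      using epsilon_square[OF assms, of "snd (w ! i)"] assms
      by (simp add: dir_of_def flow_orientation_def cpl_eq)
  qed simp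
  also have "\<dots> = cpl x * int (card {i. i < length w \<and> fst (w ! i) = x})"
    by simp
  also have "card {i. i < length w \<and> fst (w ! i) = x} = mult w x"
    unfolding mult_def count_mset count_list_eq_length_filter filter_map length_map comp_def
      length_filter_conv_card by (rule arg_cong[of _ _ card]) auto
  finally show ?thesis .
qed

text \<open>If the circuit used less than \<bar>f\<bar> somewhere, it and the remainder, both with
  the signs of \<open>f\<close>, would decompose \<open>f\<close>.\<close>

lemma indecomposable_mult:
  assumes "indecomposable G \<epsilon> f" "circuit w" "\<And>e. e \<in> edges G \<Longrightarrow> int (mult w e) \<le> \<bar>f e\<bar>" "e \<in> edges G"
  shows "\<bar>f e\<bar> = int (mult w e)"
proof (rule ccontr)
  assume neq: "\<bar>f e\<bar> \<noteq> int (mult w e)"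
  have flow: "integral_flow G orient_flow (\<lambda>e. \<bar>f e\<bar>)"
    using assms(1) integral_flow_abs by (simp add: indecomposable_def nontrivial_flow_def)
  define f1 where "f1 e = cpl e * int (mult w e)" for e
  define f2 where "f2 e = cpl e * (\<bar>f e\<bar> - int (mult w e))" for e
  have "integral_flow G \<epsilon> f1"
    unfolding f1_def[abs_def] integral_flow_cpl by (rule circuit_flow[OF assms(2)])
  moreover have "integral_flow G \<epsilon> f2"
    unfolding f2_def[abs_def] integral_flow_cpl by (rule integral_flow_diff[OF flow circuit_flow[OF assms(2)]])
  moreover obtain e\<^sub>1 where "e\<^sub>1 \<in> edges G" "mult w e\<^sub>1 > 0"
    using circuit_mult_pos[OF assms(2)] by auto
  then have "e\<^sub>1 \<in> flow_supp G f1"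
    by (simp add: flow_supp_def f1_def cpl_eq)
  moreover have "e \<in> flow_supp G f2"
    using assms(4) neq cpl_eq[OF assms(4)] by (simp add: flow_supp_def f2_def)
  moreover have "f e = f1 e + f2 e \<and> f1 e * f2 e \<ge> 0" if "e \<in> edges G" for e
  proof -
    have "0 \<le> int (mult w e) * (\<bar>f e\<bar> - int (mult w e))"
      using assms(3)[OF that] by simp
    then show ?thesis
      by (auto simp: f1_def f2_def cpl_eq[OF that] algebra_simps)
  qed
  ultimately have "decomposable G \<epsilon> f"
    unfolding decomposable_def nontrivial_flow_def by (intro exI[of _ f1] exI[of _ f2]) auto
  then show False
    using assms(1) by (simp add: indecomposable_def)
qed

end

theorem theorem2p7:
  fixes G :: "('v, 'e) sgraph"
    and \<epsilon> :: "'e \<Rightarrow> bool \<Rightarrow> int"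
    and f :: "'e \<Rightarrow> int"
  assumes "signed_graph G"
    and "orientation G \<epsilon>"
    and "nontrivial_flow G \<epsilon> f"
  shows
    "(\<exists>(n::nat) W T \<C> \<P>.
        (\<forall>i<n. minimal_directed_eulerian_walk G (W i) (dir_of (flow_orientation \<epsilon> f) (W i)) \<and>
               T i = walk_subgraph G (W i) \<and>
               eulerian_cycle_tree G (T i) (\<C> i) (\<P> i)) \<and>
        (\<forall>x\<in>edges G.
           f x = (\<Sum>i<n. char_vec \<epsilon> (W i) (dir_of (flow_orientation \<epsilon> f) (W i)) x) \<and>
           f x = (\<Sum>i<n. coupling \<epsilon> (flow_orientation \<epsilon> f) x * tree_indicator (\<C> i) (\<P> i) x)))
     \<and>
     (indecomposable G \<epsilon> f \<longrightarrow>
       (\<exists>W T \<C> \<P>.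
          minimal_directed_eulerian_walk G W (dir_of (flow_orientation \<epsilon> f) W) \<and>
          T = walk_subgraph G W \<and>
          eulerian_cycle_tree G T \<C> \<P> \<and>
          (\<forall>x\<in>edges G.
             f x = char_vec \<epsilon> W (dir_of (flow_orientation \<epsilon> f) W) x \<and>
             f x = coupling \<epsilon> (flow_orientation \<epsilon> f) x * tree_indicator \<C> \<P> x)))"
proof -
  interpret flow_bidirected_graph G \<epsilon> f
    using assms(1,2) by unfold_locales
  have flow: "integral_flow G orient_flow (\<lambda>e. \<bar>f e\<bar>)"
    using assms(3) integral_flow_abs by (simp add: nontrivial_flow_def)
  obtain F H where tree: "\<And>w. minimal_circuit w \<Longrightarrow> eulerian_cycle_tree G (walk_subgraph G w) (F w) (H w)"
    "\<And>w e. minimal_circuit w \<Longrightarrow> tree_indicator (F w) (H w) e = int (mult w e)"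
    using minimal_circuit_cycle_tree by metis
  note minimal_walk = minimal_circuit_imp_minimal_directed_eulerian_walk
  obtain ws where ws: "\<forall>w\<in>set ws. minimal_circuit w" "\<forall>e\<in>edges G. \<bar>f e\<bar> = (\<Sum>w\<leftarrow>ws. int (mult w e))"
    using flow_decomposition[OF flow] by auto
  have ws_nth: "minimal_circuit (ws ! i)" if "i < length ws" for i
    using ws(1) that by simp
  have sum_ws: "f x = (\<Sum>i<length ws. cpl x * int (mult (ws ! i) x))" if "x \<in> edges G" for x
  proof -
    have "\<bar>f x\<bar> = (\<Sum>i<length ws. int (mult (ws ! i) x))"
      using ws(2) that by (simp add: sum_list_sum_nth atLeast0LessThan)
    then show ?thesis
      using flow_eq_cpl_abs[OF that] by (simp add: sum_distrib_left)
  qed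
  show ?thesis
  proof (intro conjI impI)
    show "\<exists>(n::nat) W T \<C> \<P>.
        (\<forall>i<n. minimal_directed_eulerian_walk G (W i) (dir_of (flow_orientation \<epsilon> f) (W i)) \<and>
               T i = walk_subgraph G (W i) \<and>
               eulerian_cycle_tree G (T i) (\<C> i) (\<P> i)) \<and>
        (\<forall>x\<in>edges G.
           f x = (\<Sum>i<n. char_vec \<epsilon> (W i) (dir_of (flow_orientation \<epsilon> f) (W i)) x) \<and>
           f x = (\<Sum>i<n. coupling \<epsilon> (flow_orientation \<epsilon> f) x * tree_indicator (\<C> i) (\<P> i) x))"
      using ws_nth minimal_walk tree sum_ws
      by (intro exI[of _ "length ws"] exI[of _ "(!) ws"] exI[of _ "\<lambda>i. walk_subgraph G (ws ! i)"]
          exI[of _ "\<lambda>i. F (ws ! i)"] exI[of _ "\<lambda>i. H (ws ! i)"]) (simp add: char_vec_mult)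
  next
    assume indecomposable: "indecomposable G \<epsilon> f"
    obtain e\<^sub>0 where "e\<^sub>0 \<in> edges G" "\<bar>f e\<^sub>0\<bar> \<noteq> 0"
      using assms(3) by (auto simp: nontrivial_flow_def flow_supp_def)
    then obtain w where w: "minimal_circuit w" "\<forall>e\<in>edges G. int (mult w e) \<le> \<bar>f e\<bar>"
      using exists_minimal_circuit[OF flow] by auto
    then have "circuit w"
      by (simp add: minimal_circuit_def)
    then have "\<bar>f x\<bar> = int (mult w x)" if "x \<in> edges G" for x
      using indecomposable_mult[OF indecomposable] w(2) that by blast
    then have "f x = cpl x * int (mult w x)" if "x \<in> edges G" for x
      using flow_eq_cpl_abs[OF that] that by simp
    then show "\<exists>W T \<C> \<P>.
          minimal_directed_eulerian_walk G W (dir_of (flow_orientation \<epsilon> f) W) \<and>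
          T = walk_subgraph G W \<and>
          eulerian_cycle_tree G T \<C> \<P> \<and>
          (\<forall>x\<in>edges G.
             f x = char_vec \<epsilon> W (dir_of (flow_orientation \<epsilon> f) W) x \<and>
             f x = coupling \<epsilon> (flow_orientation \<epsilon> f) x * tree_indicator \<C> \<P> x)"
      using w(1) minimal_walk[OF w(1)] tree[OF w(1)]
      by (intro exI[of _ w] exI[of _ "walk_subgraph G w"] exI[of _ "F w"] exI[of _ "H w"])
        (simp add: char_vec_mult)
  qed
qed

end
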